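(* Let $n\ge 2$. The BMW algebra $B(\mathrm{A}_{n-1})$ of type $\mathrm{A}_{n-1}$ is the Birman–Murakami–Wenzl algebra $BMW_n$, where $l=r$ and $m=q^{-1}-q$.
   Context: $\mathrm{A}_{n-1}$ is the Coxeter diagram which is a path on nodes $1,\dots,n-1$, with $i\sim j$ (adjacent) iff $|i-j|=1$. Let $l,x$ be indeterminates and $m=(l-l^{-1})/(1-x)\in\mathbb{Q}(l,x)$. The BMW algebra $B(M)$ of a simply laced Coxeter diagram $M$ is the algebra with unit element over $\mathbb{Q}(l,x)$ presented by generators $g_i,e_i$ ($i$ a node of $M$) and defining relations: (B1) $g_ig_j=g_jg_i$ when $i\not\sim j$; (B2) $g_ig_jg_i=g_jg_ig_j$ when $i\sim j$; (D1) $me_i=l(g_i^2+mg_i-1)$ for all $i$; (R1) $g_ie_i=l^{-1}e_i$ for all $i$; (R2) $e_ig_je_i=le_i$ when $i\sim j$. Let $q,r$ be indeterminates. The Birman–Murakami–Wenzl algebra $BMW_k$ is the algebra over $\mathbb{C}(r,q)$ generated by $1,g_1,\dots,g_{k-1}$, which are assumed to be invertible, subject to the relations $g_ig_{i+1}g_i=g_{i+1}g_ig_{i+1}$; $g_ig_j=g_jg_i$ if $|i-j|\ge 2$; $e_ig_i=r^{-1}e_i$; $e_ig_{i-1}^{\pm1}e_i=r^{\pm1}e_i$, where $e_i$ is defined by the equation $(q-q^{-1})(1-e_i)=g_i-g_i^{-1}$. *)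

theory Defs
  imports
    "HOL-Algebra.Algebra"
    "HOL-Algebra.Algebraic_Closure_Type"
    "HOL-Library.Poly_Mapping"
    "HOL-Computational_Algebra.Fraction_Field"
    "HOL-Computational_Algebra.Polynomial"
begin

section \<open>Associative unital algebras over a field\<close>

text \<open>
  The scalars form a type of class field.  An algebra over it is a \<^term>\<open>module\<close> record (a ring
  record with a scalar multiplication); it need not be commutative, so the locale
  \<^locale>\<open>algebra\<close> of the library, which is about commutative algebras, does not apply.
\<close>

definition quotient_algebra ::
    "('k, 'a, 'm) module_scheme \<Rightarrow> 'a set \<Rightarrow> ('k, 'a set) module" where
  "quotient_algebra A I =
    ring.extend (A Quot I) (module.fields (\<lambda>c S. \<Union>x\<in>S. I +>\<^bsub>A\<^esub> (c \<odot>\<^bsub>A\<^esub> x)))"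

definition algebra_iso ::
    "('k, 'a, 'm) module_scheme \<Rightarrow> ('k, 'b, 'n) module_scheme \<Rightarrow> ('a \<Rightarrow> 'b) set" where
  "algebra_iso A B =
    {h \<in> ring_iso A B. \<forall>c. \<forall>a\<in>carrier A. h (c \<odot>\<^bsub>A\<^esub> a) = c \<odot>\<^bsub>B\<^esub> h a}"

definition monoid_algebra :: "('a, 'm) monoid_scheme \<Rightarrow> ('k::field, 'a \<Rightarrow>\<^sub>0 'k) module" where
  "monoid_algebra M =
    \<lparr>carrier = {f. Poly_Mapping.keys f \<subseteq> carrier M},
     monoid.mult = (\<lambda>f g. \<Sum>u\<in>Poly_Mapping.keys f. \<Sum>v\<in>Poly_Mapping.keys g.
        Poly_Mapping.single (u \<otimes>\<^bsub>M\<^esub> v) (Poly_Mapping.lookup f u * Poly_Mapping.lookup g v)),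
     one = Poly_Mapping.single \<one>\<^bsub>M\<^esub> 1,
     ring.zero = 0,
     add = (+),
     module.smult = (\<lambda>c. Poly_Mapping.map ((*) c))\<rparr>"


subsection \<open>Algebras given by generators and relations\<close>

definition free_monoid :: "'v set \<Rightarrow> 'v list monoid" where
  "free_monoid V = \<lparr>carrier = lists V, monoid.mult = (@), one = []\<rparr>"

definition free_algebra :: "'v set \<Rightarrow> ('k::field, 'v list \<Rightarrow>\<^sub>0 'k) module" where
  "free_algebra V = monoid_algebra (free_monoid V)"

definition var :: "'v \<Rightarrow> 'v list \<Rightarrow>\<^sub>0 'k::field" where
  "var v = Poly_Mapping.single [v] 1"

definition relations_ideal ::
    "'v set \<Rightarrow> (('v list \<Rightarrow>\<^sub>0 'k::field) \<times> ('v list \<Rightarrow>\<^sub>0 'k)) set \<Rightarrow> ('v list \<Rightarrow>\<^sub>0 'k) set" where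
  "relations_ideal V R = Idl\<^bsub>free_algebra V\<^esub> {a \<ominus>\<^bsub>free_algebra V\<^esub> b | a b. (a, b) \<in> R}"

definition presented_algebra ::
    "'v set \<Rightarrow> (('v list \<Rightarrow>\<^sub>0 'k::field) \<times> ('v list \<Rightarrow>\<^sub>0 'k)) set
      \<Rightarrow> ('k, ('v list \<Rightarrow>\<^sub>0 'k) set) module" where
  "presented_algebra V R = quotient_algebra (free_algebra V) (relations_ideal V R)"

definition presented_class ::
    "'v set \<Rightarrow> (('v list \<Rightarrow>\<^sub>0 'k::field) \<times> ('v list \<Rightarrow>\<^sub>0 'k)) set
      \<Rightarrow> ('v list \<Rightarrow>\<^sub>0 'k) \<Rightarrow> ('v list \<Rightarrow>\<^sub>0 'k) set" where
  "presented_class V R a = relations_ideal V R +>\<^bsub>free_algebra V\<^esub> a"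


subsection \<open>Extension of scalars\<close>

text \<open>
  For a field homomorphism \<open>\<iota> : k \<rightarrow> K\<close> and a \<open>k\<close>-algebra \<open>A\<close>, the \<open>K\<close>-algebra \<open>K \<otimes>\<^sub>k A\<close>:
  the \<open>K\<close>-vector space with basis the symbols \<open>[a]\<close>, multiplied by \<open>[a][b] = [ab]\<close>, modulo
  \<open>[a + b] = [a] + [b]\<close> and \<open>[ca] = \<iota>(c)[a]\<close>.  The class of \<open>c[a]\<close> is the tensor \<open>c \<otimes> a\<close>.  The
  ideal generated by these relations is already their \<open>K\<close>-span, because multiplying a relation by
  a symbol gives a relation of the same form.
\<close>

definition tensor_ideal ::
    "('k::field \<Rightarrow> 'K::field) \<Rightarrow> ('k, 'a, 'm) module_scheme \<Rightarrow> ('a \<Rightarrow>\<^sub>0 'K) set" where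
  "tensor_ideal \<iota> A = Idl\<^bsub>monoid_algebra A\<^esub>
    ({Poly_Mapping.single (a \<oplus>\<^bsub>A\<^esub> b) 1 - (Poly_Mapping.single a 1 + Poly_Mapping.single b 1)
        | a b. a \<in> carrier A \<and> b \<in> carrier A}
     \<union> {Poly_Mapping.single (c \<odot>\<^bsub>A\<^esub> a) 1 - Poly_Mapping.single a (\<iota> c)
        | c a. a \<in> carrier A})"

definition extend_scalars ::
    "('k::field \<Rightarrow> 'K::field) \<Rightarrow> ('k, 'a, 'm) module_scheme \<Rightarrow> ('K, ('a \<Rightarrow>\<^sub>0 'K) set) module" where
  "extend_scalars \<iota> A = quotient_algebra (monoid_algebra A) (tensor_ideal \<iota> A)"

definition tensor ::
    "('k::field \<Rightarrow> 'K::field) \<Rightarrow> ('k, 'a, 'm) module_scheme \<Rightarrow> 'K \<Rightarrow> 'a \<Rightarrow> ('a \<Rightarrow>\<^sub>0 'K) set" where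
  "tensor \<iota> A c a = tensor_ideal \<iota> A +>\<^bsub>monoid_algebra A\<^esub> Poly_Mapping.single a c"


section \<open>Rational functions in two indeterminates\<close>

type_synonym 'k ratfun2 = "'k poly poly fract"

definition indet1 :: "'k::field ratfun2" where
  "indet1 = Fract [:[:0, 1:]:] 1"

definition indet2 :: "'k::field ratfun2" where
  "indet2 = Fract [:0, 1:] 1"

definition par_l :: "rat ratfun2" where "par_l = indet1"
definition par_x :: "rat ratfun2" where "par_x = indet2"
definition par_m :: "rat ratfun2" where
  "par_m = (par_l - inverse par_l) / (1 - par_x)"

definition par_r :: "complex ratfun2" where "par_r = indet1"
definition par_q :: "complex ratfun2" where "par_q = indet2"


section \<open>The BMW algebra of a simply laced Coxeter diagram\<close>

text \<open>
  A simply laced Coxeter diagram is given by its set \<open>I\<close> of nodes and its adjacency relation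
  \<open>adj\<close>.
\<close>

datatype 'v gen = Gen_g 'v | Gen_e 'v

definition B_gens :: "'v set \<Rightarrow> 'v gen set" where
  "B_gens I = Gen_g ` I \<union> Gen_e ` I"

definition B_rels ::
    "'v set \<Rightarrow> ('v \<Rightarrow> 'v \<Rightarrow> bool)
      \<Rightarrow> (('v gen list \<Rightarrow>\<^sub>0 rat ratfun2) \<times> ('v gen list \<Rightarrow>\<^sub>0 rat ratfun2)) set" where
  "B_rels I adj =
    (let F = free_algebra (B_gens I);
         g = (\<lambda>i. var (Gen_g i));
         e = (\<lambda>i. var (Gen_e i));
         l = par_l;
         m = par_m
     in {(g i \<otimes>\<^bsub>F\<^esub> g j, g j \<otimes>\<^bsub>F\<^esub> g i) | i j. i \<in> I \<and> j \<in> I \<and> \<not> adj i j}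
      \<union> {(g i \<otimes>\<^bsub>F\<^esub> g j \<otimes>\<^bsub>F\<^esub> g i, g j \<otimes>\<^bsub>F\<^esub> g i \<otimes>\<^bsub>F\<^esub> g j) | i j. i \<in> I \<and> j \<in> I \<and> adj i j}
      \<union> {(m \<odot>\<^bsub>F\<^esub> e i, l \<odot>\<^bsub>F\<^esub> (g i [^]\<^bsub>F\<^esub> (2::nat) \<oplus>\<^bsub>F\<^esub> m \<odot>\<^bsub>F\<^esub> g i \<ominus>\<^bsub>F\<^esub> \<one>\<^bsub>F\<^esub>)) | i. i \<in> I}
      \<union> {(g i \<otimes>\<^bsub>F\<^esub> e i, inverse l \<odot>\<^bsub>F\<^esub> e i) | i. i \<in> I}
      \<union> {(e i \<otimes>\<^bsub>F\<^esub> g j \<otimes>\<^bsub>F\<^esub> e i, l \<odot>\<^bsub>F\<^esub> e i) | i j. i \<in> I \<and> j \<in> I \<and> adj i j})"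

definition B_algebra ::
    "'v set \<Rightarrow> ('v \<Rightarrow> 'v \<Rightarrow> bool) \<Rightarrow> (rat ratfun2, ('v gen list \<Rightarrow>\<^sub>0 rat ratfun2) set) module" where
  "B_algebra I adj = presented_algebra (B_gens I) (B_rels I adj)"

definition B_g :: "'v set \<Rightarrow> ('v \<Rightarrow> 'v \<Rightarrow> bool) \<Rightarrow> 'v \<Rightarrow> ('v gen list \<Rightarrow>\<^sub>0 rat ratfun2) set" where
  "B_g I adj i = presented_class (B_gens I) (B_rels I adj) (var (Gen_g i))"

definition B_e :: "'v set \<Rightarrow> ('v \<Rightarrow> 'v \<Rightarrow> bool) \<Rightarrow> 'v \<Rightarrow> ('v gen list \<Rightarrow>\<^sub>0 rat ratfun2) set" where
  "B_e I adj i = presented_class (B_gens I) (B_rels I adj) (var (Gen_e i))"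

definition A_nodes :: "nat \<Rightarrow> nat set" where
  "A_nodes k = {1..k}"

definition A_adj :: "nat \<Rightarrow> nat \<Rightarrow> bool" where
  "A_adj i j \<longleftrightarrow> \<bar>int i - int j\<bar> = 1"


section \<open>The Birman--Murakami--Wenzl algebra\<close>

text \<open>
  Invertibility of the generators is presented by additional generators for the inverses;
  \<open>BMW_elem_e k i\<close> is the element of the free algebra solving, for \<open>e\<^sub>i\<close>, the equation
  \<open>(q - q\<^sup>-\<^sup>1)(1 - e\<^sub>i) = g\<^sub>i - g\<^sub>i\<^sup>-\<^sup>1\<close>.
\<close>

datatype bmw_gen = Bmw_g nat | Bmw_ginv nat

definition BMW_gens :: "nat \<Rightarrow> bmw_gen set" where
  "BMW_gens k = Bmw_g ` {1..<k} \<union> Bmw_ginv ` {1..<k}"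

definition BMW_elem_e :: "nat \<Rightarrow> nat \<Rightarrow> bmw_gen list \<Rightarrow>\<^sub>0 complex ratfun2" where
  "BMW_elem_e k i =
    (let F = free_algebra (BMW_gens k)
     in \<one>\<^bsub>F\<^esub> \<ominus>\<^bsub>F\<^esub> inverse (par_q - inverse par_q) \<odot>\<^bsub>F\<^esub> (var (Bmw_g i) \<ominus>\<^bsub>F\<^esub> var (Bmw_ginv i)))"

definition BMW_rels ::
    "nat \<Rightarrow> ((bmw_gen list \<Rightarrow>\<^sub>0 complex ratfun2) \<times> (bmw_gen list \<Rightarrow>\<^sub>0 complex ratfun2)) set" where
  "BMW_rels k =
    (let F = free_algebra (BMW_gens k);
         N = {1..<k};
         g = (\<lambda>i. var (Bmw_g i));
         g' = (\<lambda>i. var (Bmw_ginv i));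
         e = BMW_elem_e k;
         r = par_r
     in {(g i \<otimes>\<^bsub>F\<^esub> g' i, \<one>\<^bsub>F\<^esub>) | i. i \<in> N}
      \<union> {(g' i \<otimes>\<^bsub>F\<^esub> g i, \<one>\<^bsub>F\<^esub>) | i. i \<in> N}
      \<union> {(g i \<otimes>\<^bsub>F\<^esub> g (i + 1) \<otimes>\<^bsub>F\<^esub> g i, g (i + 1) \<otimes>\<^bsub>F\<^esub> g i \<otimes>\<^bsub>F\<^esub> g (i + 1)) | i. i \<in> N \<and> i + 1 \<in> N}
      \<union> {(g i \<otimes>\<^bsub>F\<^esub> g j, g j \<otimes>\<^bsub>F\<^esub> g i) | i j. i \<in> N \<and> j \<in> N \<and> \<bar>int i - int j\<bar> \<ge> 2}
      \<union> {(e i \<otimes>\<^bsub>F\<^esub> g i, inverse r \<odot>\<^bsub>F\<^esub> e i) | i. i \<in> N}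
      \<union> {(e i \<otimes>\<^bsub>F\<^esub> g (i - 1) \<otimes>\<^bsub>F\<^esub> e i, r \<odot>\<^bsub>F\<^esub> e i) | i. i \<in> N \<and> i - 1 \<in> N}
      \<union> {(e i \<otimes>\<^bsub>F\<^esub> g' (i - 1) \<otimes>\<^bsub>F\<^esub> e i, inverse r \<odot>\<^bsub>F\<^esub> e i) | i. i \<in> N \<and> i - 1 \<in> N})"

definition BMW :: "nat \<Rightarrow> (complex ratfun2, (bmw_gen list \<Rightarrow>\<^sub>0 complex ratfun2) set) module" where
  "BMW k = presented_algebra (BMW_gens k) (BMW_rels k)"

definition BMW_g :: "nat \<Rightarrow> nat \<Rightarrow> (bmw_gen list \<Rightarrow>\<^sub>0 complex ratfun2) set" where
  "BMW_g k i = presented_class (BMW_gens k) (BMW_rels k) (var (Bmw_g i))"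

definition BMW_e :: "nat \<Rightarrow> nat \<Rightarrow> (bmw_gen list \<Rightarrow>\<^sub>0 complex ratfun2) set" where
  "BMW_e k i = presented_class (BMW_gens k) (BMW_rels k) (BMW_elem_e k i)"

end

theory Submission
  imports Defs
begin

text \<open>
  The embedding of scalars sends \<open>l\<close> to \<open>r\<close> and \<open>x\<close> to \<open>1 - (r - r\<^sup>-\<^sup>1) / (q\<^sup>-\<^sup>1 - q)\<close>, which is
  transcendental over \<open>\<complex>(r)\<close>.  Both algebras have universal properties, so mutually inverse
  homomorphisms arise as soon as the defining relations on either side imply those on the other.

  From (D1) and (R1) one gets \<open>g\<^sub>i\<^sup>-\<^sup>1 = g\<^sub>i + m - m e\<^sub>i\<close>.  For adjacent nodes the braid relation gives
  \<open>g\<^sub>j g\<^sub>i e\<^sub>j = e\<^sub>i g\<^sub>j g\<^sub>i\<close>, which with (R2) yields \<open>e\<^sub>j e\<^sub>i = g\<^sub>i\<^sup>-\<^sup>1 g\<^sub>j\<^sup>-\<^sup>1 e\<^sub>i\<close>, hence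
  \<open>e\<^sub>i e\<^sub>j e\<^sub>i = l w\<close> for \<open>w = e\<^sub>i g\<^sub>j\<^sup>-\<^sup>1 e\<^sub>i\<close>.  Expanding the inverse in \<open>w\<close> gives
  \<open>(1 + l m) w = l\<^sup>-\<^sup>1 (1 + l m) e\<^sub>i\<close>, and \<open>1 + l m \<noteq> 0\<close>.  Conversely, the relation
  \<open>e\<^sub>i g\<^sub>i\<^sub>+\<^sub>1 e\<^sub>i = r e\<^sub>i\<close>, absent from the presentation of \<open>BMW\<^sub>n\<close>, follows from the one with
  \<open>i\<close> and \<open>i + 1\<close> exchanged, because conjugation by \<open>g\<^sub>i g\<^sub>i\<^sub>+\<^sub>1 g\<^sub>i\<close> exchanges the two nodes.
\<close>

section \<open>The embedding of scalars\<close>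

locale scalar_hom =
  fixes h :: "'a::comm_ring_1 \<Rightarrow> 'b::comm_ring_1"
  assumes add: "h (a + b) = h a + h b" and mult: "h (a * b) = h a * h b" and one: "h 1 = 1"
begin

lemma zero: "h 0 = 0"
  using add[of 0 0] by simp

lemma uminus: "h (- a) = - h a"
  using add[of a "- a"] by (simp add: zero eq_neg_iff_add_eq_0 add.commute)

lemma diff: "h (a - b) = h a - h b"
  using add[of a "- b"] by (simp add: uminus)

text \<open>Extends \<open>h\<close> to polynomials by sending the variable to \<open>x\<close>. The
  locale asks only for commutative rings, so the construction can be iterated: on
  \<open>rat poly poly\<close> the inner variable is l and the outer one is x.\<close>

definition eval :: "'b \<Rightarrow> 'a poly \<Rightarrow> 'b" where
  "eval x p = poly (map_poly h p) x"

lemma eval_0: "eval x 0 = 0"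
  by (simp add: eval_def)

lemma eval_pCons: "eval x (pCons a p) = h a + x * eval x p"
  by (simp add: eval_def map_poly_pCons zero)

lemma eval_add: "eval x (p + q) = eval x p + eval x q"
  by (induction p q rule: poly_induct2) (simp_all add: eval_pCons eval_0 add algebra_simps)

lemma eval_smult: "eval x (Polynomial.smult a p) = h a * eval x p"
  by (induction p) (simp_all add: eval_pCons eval_0 mult algebra_simps)

lemma eval_mult: "eval x (p * q) = eval x p * eval x q"
  by (induction p) (simp_all add: eval_pCons eval_0 eval_add eval_smult zero algebra_simps)

lemma scalar_hom_eval: "scalar_hom (eval x)"
  by unfold_locales (simp_all add: eval_add eval_mult one_pCons eval_pCons eval_0 one)

lemma eval_altdef: "eval x p = (\<Sum>i\<le>degree p. h (Polynomial.coeff p i) * x ^ i)"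
proof -
  \<comment> \<open>\<open>h\<close> may kill leading coefficients, so the degree of the mapped
    polynomial is only bounded by \<open>degree p\<close>; the added terms vanish.\<close>
  have "eval x p = (\<Sum>i\<le>degree p. Polynomial.coeff (map_poly h p) i * x ^ i)"
    unfolding eval_def poly_altdef
    by (rule sum.mono_neutral_left) (auto simp: map_poly_degree_leq coeff_eq_0)
  then show ?thesis by (simp add: coeff_map_poly zero)
qed

end

lemma scalar_hom_id: "scalar_hom (\<lambda>c. c)"
  by unfold_locales simp_all

lemma scalar_hom_inverse:
  fixes h :: "'a::field \<Rightarrow> 'b::field"
  assumes "scalar_hom h"
  shows "h (inverse a) = inverse (h a)"
proof (cases "a = 0")
  case False
  then have "h a * h (inverse a) = 1"
    using scalar_hom.mult[OF assms, of a "inverse a"] scalar_hom.one[OF assms] by simp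
  then show ?thesis by (metis inverse_unique)
qed (simp add: scalar_hom.zero[OF assms])

lemma scalar_hom_divide:
  fixes h :: "'a::field \<Rightarrow> 'b::field"
  assumes "scalar_hom h"
  shows "h (a / b) = h a / h b"
  by (simp add: divide_inverse scalar_hom.mult[OF assms] scalar_hom_inverse[OF assms])

lemma scalar_hom_iff_ring_hom:
  "h \<in> ring_hom ring_of_type_algebra ring_of_type_algebra \<longleftrightarrow> scalar_hom h"
  by (auto simp: ring_hom_def ring_of_type_algebra_def scalar_hom_def)

section \<open>Extension of injective homomorphisms to fraction fields\<close>

definition fract_extension :: "('a::idom \<Rightarrow> 'b::field) \<Rightarrow> 'a fract \<Rightarrow> 'b" where
  "fract_extension h z = (SOME w. \<exists>a b. b \<noteq> 0 \<and> z = Fract a b \<and> w = h a / h b)"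

locale injective_scalar_hom = scalar_hom h for h :: "'a::idom \<Rightarrow> 'b::field" +
  assumes nonzero: "a \<noteq> 0 \<Longrightarrow> h a \<noteq> 0"
begin

text \<open>Equal fractions cross-multiply and \<open>h\<close> keeps denominators nonzero, so the
  value does not depend on the fraction chosen in \<open>fract_extension\<close>.\<close>

lemma fract_extension_Fract:
  assumes "b \<noteq> 0"
  shows "fract_extension h (Fract a b) = h a / h b"
proof -
  have "\<exists>w. \<exists>a' b'. b' \<noteq> 0 \<and> Fract a b = Fract a' b' \<and> w = h a' / h b'"
    using assms by blast
  from someI_ex[OF this] obtain a' b' where
    "b' \<noteq> 0" "Fract a b = Fract a' b'" "fract_extension h (Fract a b) = h a' / h b'"
    unfolding fract_extension_def by blast
  moreover from this have "h a * h b' = h a' * h b"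
    using assms by (simp add: eq_fract flip: mult)
  ultimately show ?thesis using assms by (simp add: nonzero frac_eq_eq)
qed

lemma fract_extension_to_fract: "fract_extension h (to_fract a) = h a"
  by (simp add: to_fract_def fract_extension_Fract one)

lemma scalar_hom_fract_extension: "scalar_hom (fract_extension h)"
proof
  fix y z :: "'a fract"
  obtain a b where y: "y = Fract a b" "b \<noteq> 0" by (cases y) auto
  obtain c d where z: "z = Fract c d" "d \<noteq> 0" by (cases z) auto
  show "fract_extension h (y + z) = fract_extension h y + fract_extension h z"
    using y z by (simp add: fract_extension_Fract add mult nonzero add_frac_eq)
  show "fract_extension h (y * z) = fract_extension h y * fract_extension h z"
    using y z by (simp add: fract_extension_Fract mult)
next
  show "fract_extension h 1 = 1"
    by (simp add: One_fract_def fract_extension_Fract one)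
qed

end

section \<open>Nonvanishing of scalars in C(r, q)\<close>

lemma par_r_eq: "par_r = to_fract [:[:0, 1:]:]"
  by (simp add: par_r_def indet1_def to_fract_def)

lemma par_q_eq: "par_q = to_fract [:0, 1:]"
  by (simp add: par_q_def indet2_def to_fract_def)

lemma par_r_nonzero: "par_r \<noteq> 0" and par_q_nonzero: "par_q \<noteq> 0"
  by (simp_all add: par_r_eq par_q_eq)

text \<open>The map \<open>to_fract\<close> is injective, so the claim is checked in the polynomial
  ring. It serves to show that q - q^-1, and hence m, is nonzero.\<close>

lemma par_q_square: "par_q\<^sup>2 \<noteq> 1"
proof -
  have "[:0, 1:] * [:0, 1:] \<noteq> (1 :: complex poly poly)" by (simp add: one_pCons)
  then show ?thesis
    unfolding par_q_eq power2_eq_square to_fract_mult[symmetric] to_fract_1[symmetric]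
    by (simp only: to_fract_eq_iff not_False_eq_True)
qed

text \<open>In \<open>ex_scalar_embedding\<close> the factor r - r^-1 has to be cancelled to recover
  the image of m from that of x.\<close>

lemma par_r_square: "par_r\<^sup>2 \<noteq> 1"
proof -
  have "[:[:0, 1:]:] * [:[:0, 1:]:] \<noteq> (1 :: complex poly poly)" by (simp add: one_pCons)
  then show ?thesis
    unfolding par_r_eq power2_eq_square to_fract_mult[symmetric] to_fract_1[symmetric]
    by (simp only: to_fract_eq_iff not_False_eq_True)
qed

lemma par_q_diff_nonzero: "par_q - inverse par_q \<noteq> 0"
  using par_q_square par_q_nonzero by (auto simp: power2_eq_square field_simps)

text \<open>This is the factor cancelled in \<open>e_h'_e\<close>. Multiplying by q turns its
  vanishing into q + r = r q^2, which is false for polynomials.\<close>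

lemma one_plus_r_m_nonzero: "1 + par_r * (inverse par_q - par_q) \<noteq> 0"
proof
  assume "1 + par_r * (inverse par_q - par_q) = 0"
  then have "par_q + par_r = par_r * (par_q * par_q)"
    using par_q_nonzero by (simp add: field_simps)
  then have "[:0, 1:] + [:[:0, 1:]:] = [:[:0, 1:]:] * ([:0, 1:] * [:0, 1:] :: complex poly poly)"
    unfolding par_r_eq par_q_eq to_fract_mult[symmetric] to_fract_add[symmetric]
    by (simp only: to_fract_eq_iff)
  then show False by simp
qed

section \<open>The homomorphism from Q(l, x) to C(r, q)\<close>

definition const_emb :: "rat \<Rightarrow> complex ratfun2" where
  "const_emb c = to_fract [:[:of_rat c:]:]"

interpretation const_emb: scalar_hom const_emb
  by unfold_locales
    (simp_all add: const_emb_def of_rat_add of_rat_mult one_pCons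
      flip: to_fract_add to_fract_mult to_fract_1)

text \<open>A coefficient in l becomes a polynomial in r alone, constant in the outer variable q, so
  that it survives unchanged when q is set to 1 later.\<close>

lemma const_emb_eval_r: "const_emb.eval par_r a = to_fract [:map_poly of_rat a:]"
proof (induction a)
  case (pCons c a)
  have "[:map_poly of_rat (pCons c a):]
      = [:[:of_rat c :: complex:]:] + [:[:0, 1:]:] * [:map_poly of_rat a:]"
    by (simp add: map_poly_pCons)
  then show ?case
    by (simp only: const_emb.eval_pCons pCons.IH to_fract_add to_fract_mult)
      (simp add: const_emb_def par_r_eq)
qed (simp add: const_emb.eval_0)

interpretation eval_r: scalar_hom "const_emb.eval par_r"
  by (rule const_emb.scalar_hom_eval)

text \<open>The value forced by solving m = (l - l^-1) / (1 - x) for x, with l sent to r and m to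
  q^-1 - q.\<close>

definition x_image :: "complex ratfun2" where
  "x_image = 1 - (par_r - inverse par_r) / (inverse par_q - par_q)"

text \<open>
  Multiplying the value by \<open>(r (1 - q\<^sup>2))\<^sup>d\<close>, where \<open>d\<close> is the degree in \<open>x\<close>, clears denominators;
  at \<open>q = 1\<close> only the leading coefficient survives, with the factor \<open>(1 - r\<^sup>2)\<^sup>d\<close>.
\<close>
lemma eval_x_image_nonzero:
  assumes "p \<noteq> 0"
  shows "eval_r.eval x_image p \<noteq> 0"
proof
  assume zero: "eval_r.eval x_image p = 0"
  \<comment> \<open>\<open>R\<close> and \<open>Q\<close> are r and q as polynomials.
    \<open>V\<close> = r (1 - q^2) clears the denominator of \<open>x_image\<close>, and
    \<open>U\<close> is the polynomial equal to \<open>x_image\<close> times \<open>V\<close>; hence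
    \<open>S\<close> represents \<open>V\<close>^d times the value at
    \<open>x_image\<close>.\<close>
  define R Q V U :: "complex poly poly" where "R = [:[:0, 1:]:]" and "Q = [:0, 1:]"
    and "V = R * (1 - Q * Q)" and "U = V - (R * R - 1) * Q"
  define d where "d = degree p"
  define c where "c i = (map_poly of_rat (Polynomial.coeff p i) :: complex poly)" for i
  define S where "S = (\<Sum>i\<le>d. [:c i:] * U ^ i * V ^ (d - i))"
  have RQ: "to_fract R = par_r" "to_fract Q = par_q"
    by (simp_all add: R_def Q_def par_r_eq par_q_eq)
  have V: "to_fract V = par_r * (1 - par_q * par_q)"
    by (simp add: V_def RQ)
  have nz: "1 - par_q * par_q \<noteq> 0" using par_q_square by (simp add: power2_eq_square)
  have "inverse par_q - par_q = (1 - par_q * par_q) / par_q"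
    using par_q_nonzero by (simp add: field_simps)
  then have "x_image = 1 - (par_r - inverse par_r) * par_q / (1 - par_q * par_q)"
    by (simp add: x_image_def)
  then have "x_image * to_fract V = to_fract V - (par_r * par_r - 1) * par_q"
    using nz par_r_nonzero unfolding V by (simp add: field_simps)
  then have U: "to_fract U = x_image * to_fract V"
    by (simp add: U_def RQ)
  have pow: "to_fract (a ^ i) = to_fract a ^ i" for a :: "complex poly poly" and i
    by (induction i) simp_all
  have sum: "to_fract (\<Sum>i\<in>A. f i) = (\<Sum>i\<in>A. to_fract (f i))"
    for f :: "nat \<Rightarrow> complex poly poly" and A
    by (induction A rule: infinite_finite_induct) simp_all
  have "to_fract S = (\<Sum>i\<le>d. to_fract V ^ d * (to_fract [:c i:] * x_image ^ i))"
    unfolding S_def sum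
  proof (rule sum.cong)
    fix i assume "i \<in> {..d}"
    then have "to_fract V ^ d = to_fract V ^ i * to_fract V ^ (d - i)"
      by (simp flip: power_add)
    then show "to_fract ([:c i:] * U ^ i * V ^ (d - i))
        = to_fract V ^ d * (to_fract [:c i:] * x_image ^ i)"
      by (simp only: pow U power_mult_distrib to_fract_mult mult_ac)
  qed simp
  also have "\<dots> = to_fract V ^ d * eval_r.eval x_image p"
    by (simp add: eval_r.eval_altdef const_emb_eval_r c_def d_def sum_distrib_left)
  finally have "S = 0" using zero by simp
  \<comment> \<open>Setting the outer variable q to 1 leaves polynomials in r, so
    \<open>[:0, 1:]\<close> now stands for r. \<open>V\<close> becomes 0 and \<open>U\<close>
    becomes 1 - r^2; only the summand i = d has no factor \<open>V\<close>.\<close>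
  moreover have "poly S 1 = c d * (1 - [:0, 1:] * [:0, 1:]) ^ d"
  proof -
    have VU: "poly V 1 = 0" "poly U 1 = 1 - [:0, 1:] * [:0, 1:]"
      by (simp_all add: V_def U_def R_def Q_def)
    have "poly S 1 = (\<Sum>i\<le>d. c i * poly U 1 ^ i * poly V 1 ^ (d - i))"
      by (simp add: S_def poly_sum mult.assoc)
    also have "\<dots> = (\<Sum>i\<in>{d}. c i * poly U 1 ^ i * poly V 1 ^ (d - i))"
      by (rule sum.mono_neutral_right) (auto simp: VU(1))
    finally show ?thesis by (simp only: VU(2)) simp
  qed
  moreover have "c d \<noteq> 0"
    using assms by (simp add: c_def d_def map_poly_eq_0_iff)
  moreover have "1 - [:0, 1:] * [:0, 1:] \<noteq> (0 :: complex poly)"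
    by (simp add: one_pCons)
  ultimately show False by simp
qed

interpretation eval_x: injective_scalar_hom "eval_r.eval x_image"
  using eval_r.scalar_hom_eval eval_x_image_nonzero
  by (simp add: injective_scalar_hom_def injective_scalar_hom_axioms_def)

lemma ex_scalar_embedding:
  "\<exists>\<iota>. scalar_hom \<iota> \<and> \<iota> par_l = par_r \<and> \<iota> par_m = inverse par_q - par_q"
proof (intro exI conjI)
  let ?\<iota> = "fract_extension (eval_r.eval x_image)"
  show hom: "scalar_hom ?\<iota>" by (rule eval_x.scalar_hom_fract_extension)
  have "?\<iota> par_l = ?\<iota> (to_fract [:[:0, 1:]:])"
    by (simp add: par_l_def indet1_def to_fract_def)
  also have "\<dots> = const_emb 0 + par_r * const_emb 1"
    by (simp add: eval_x.fract_extension_to_fract eval_r.eval_pCons eval_r.eval_0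
        const_emb.eval_pCons const_emb.eval_0)
  finally show l: "?\<iota> par_l = par_r"
    by (simp add: const_emb.zero const_emb.one)
  have "?\<iota> par_x = ?\<iota> (to_fract [:0, 1:])"
    by (simp add: par_x_def indet2_def to_fract_def)
  also have "\<dots> = x_image"
    by (simp add: eval_x.fract_extension_to_fract eval_r.eval_pCons eval_r.eval_0
        eval_r.zero eval_r.one)
  finally have x: "?\<iota> par_x = x_image" .
  have "par_r - inverse par_r \<noteq> 0"
    using par_r_square par_r_nonzero by (auto simp: power2_eq_square field_simps)
  then have "(par_r - inverse par_r) / (1 - x_image) = inverse par_q - par_q"
    by (simp add: x_image_def)
  then show "?\<iota> par_m = inverse par_q - par_q"
    by (simp only: par_m_def scalar_hom_divide[OF hom] scalar_hom.diff[OF hom] scalar_hom.one[OF hom]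
        scalar_hom_inverse[OF hom] l x)
qed

section \<open>The BMW relations in an associative algebra\<close>

locale assoc_algebra = ring A for A :: "('k::field, 'a, 'm) module_scheme" (structure) +
  assumes smult_closed [simp, intro]: "a \<in> carrier A \<Longrightarrow> c \<odot> a \<in> carrier A"
    and smult_l_distr: "a \<in> carrier A \<Longrightarrow> (c + d) \<odot> a = c \<odot> a \<oplus> d \<odot> a"
    and smult_r_distr: "a \<in> carrier A \<Longrightarrow> b \<in> carrier A \<Longrightarrow> c \<odot> (a \<oplus> b) = c \<odot> a \<oplus> c \<odot> b"
    and smult_assoc: "a \<in> carrier A \<Longrightarrow> c \<odot> (d \<odot> a) = (c * d) \<odot> a"
    and smult_one [simp]: "a \<in> carrier A \<Longrightarrow> 1 \<odot> a = a"
    and smult_mult_left: "a \<in> carrier A \<Longrightarrow> b \<in> carrier A \<Longrightarrow> (c \<odot> a) \<otimes> b = c \<odot> (a \<otimes> b)"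
    and smult_mult_right: "a \<in> carrier A \<Longrightarrow> b \<in> carrier A \<Longrightarrow> a \<otimes> (c \<odot> b) = c \<odot> (a \<otimes> b)"
begin

lemma zero_smult [simp]:
  assumes "a \<in> carrier A"
  shows "0 \<odot> a = \<zero>"
  using smult_l_distr[OF assms, of 0 0] assms by simp

lemma smult_zero [simp]: "c \<odot> \<zero> = \<zero>"
  using smult_r_distr[of \<zero> \<zero> c] by simp

lemma uminus_smult:
  assumes "a \<in> carrier A"
  shows "(- c) \<odot> a = \<ominus> (c \<odot> a)"
  using smult_l_distr[OF assms, of "- c" c] assms by (simp add: minus_equality)

lemma smult_uminus:
  assumes "a \<in> carrier A"
  shows "c \<odot> (\<ominus> a) = \<ominus> (c \<odot> a)"
  using smult_r_distr[of "\<ominus> a" a c] assms by (simp add: l_neg minus_equality)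

lemmas alg_simps = minus_eq l_distr r_distr l_minus r_minus m_assoc smult_mult_left
  smult_mult_right smult_r_distr smult_uminus smult_assoc

lemma smult_cancel:
  assumes "c \<odot> a = c \<odot> b" "c \<noteq> 0" "a \<in> carrier A" "b \<in> carrier A"
  shows "a = b"
proof -
  have "inverse c \<odot> (c \<odot> a) = inverse c \<odot> (c \<odot> b)" by (simp only: assms(1))
  then show ?thesis using assms(2-) by (simp add: smult_assoc)
qed

lemma right_inverse_cancel:
  assumes "g \<otimes> h = \<one>" "a \<otimes> g = b \<otimes> g" "g \<in> carrier A" "h \<in> carrier A"
    "a \<in> carrier A" "b \<in> carrier A"
  shows "a = b"
  using assms by (metis m_assoc r_one)

end


text \<open>The common ground of both presentations at a single node: a generator \<open>g\<close>,
  its inverse \<open>h\<close> and the element \<open>e\<close>. It is a predicate so that it can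
  first be proved for every node of a family and then be used to interpret the locale at chosen
  nodes.\<close>

definition (in assoc_algebra) is_bmw_triple :: "'k \<Rightarrow> 'k \<Rightarrow> 'a \<Rightarrow> 'a \<Rightarrow> 'a \<Rightarrow> bool" where
  "is_bmw_triple l m g h e \<longleftrightarrow> l \<noteq> 0 \<and> m \<noteq> 0 \<and> g \<in> carrier A \<and> h \<in> carrier A \<and> e \<in> carrier A \<and>
     g \<otimes> h = \<one> \<and> h \<otimes> g = \<one> \<and> h = g \<oplus> m \<odot> \<one> \<ominus> m \<odot> e \<and>
     g \<otimes> e = inverse l \<odot> e \<and> e \<otimes> g = inverse l \<odot> e"

context assoc_algebra
begin

text \<open>By (D1) a nonzero multiple of \<open>e\<close> is a polynomial in \<open>g\<close>, so
  \<open>e\<close> commutes with \<open>g\<close>. Then (D1) divided by l, combined with (R1), says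
  that g (g + m - m e) = 1, and likewise on the other side.\<close>

lemma bmw_triple_of_D1:
  assumes [simp]: "g \<in> carrier A" "e \<in> carrier A" and nz: "l \<noteq> 0" "m \<noteq> 0"
    and D1: "m \<odot> e = l \<odot> (g \<otimes> g \<oplus> m \<odot> g \<ominus> \<one>)"
    and R1: "g \<otimes> e = inverse l \<odot> e"
  shows "is_bmw_triple l m g (g \<oplus> m \<odot> \<one> \<ominus> m \<odot> e) e"
proof -
  have "m \<odot> (e \<otimes> g) = (m \<odot> e) \<otimes> g" by (simp add: smult_mult_left)
  also have "\<dots> = g \<otimes> (m \<odot> e)" unfolding D1 by (simp add: alg_simps)
  also have "\<dots> = m \<odot> (g \<otimes> e)" by (simp add: smult_mult_right)
  finally have eg: "e \<otimes> g = inverse l \<odot> e" using nz by (simp add: R1 smult_cancel)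
  have "inverse l \<odot> (m \<odot> e) = g \<otimes> g \<oplus> m \<odot> g \<ominus> \<one>"
    unfolding D1 using nz by (simp add: smult_assoc)
  then have me: "(m * inverse l) \<odot> e = g \<otimes> g \<oplus> m \<odot> g \<ominus> \<one>"
    by (simp add: smult_assoc mult.commute)
  have gh: "g \<otimes> g \<oplus> m \<odot> g \<ominus> (g \<otimes> g \<oplus> m \<odot> g \<ominus> \<one>) = \<one>"
    by (simp add: minus_eq minus_add a_ac r_neg r_neg1 r_neg2)
  have "g \<otimes> (g \<oplus> m \<odot> \<one> \<ominus> m \<odot> e) = \<one>"
    using gh[folded me] by (simp add: alg_simps R1)
  moreover have "(g \<oplus> m \<odot> \<one> \<ominus> m \<odot> e) \<otimes> g = \<one>"
    using gh[folded me] by (simp add: alg_simps eg)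
  ultimately show ?thesis using nz by (simp add: is_bmw_triple_def R1 eg)
qed

text \<open>Here \<open>e\<close> is a linear combination of 1, \<open>g\<close> and
  \<open>h\<close>, so it commutes with \<open>g\<close>; solving its definition for
  \<open>h\<close> gives the remaining formula. The scalar has the form \<open>inverse (- m)\<close>
  because q - q^-1 = - m.\<close>

lemma bmw_triple_of_inverse:
  assumes [simp]: "g \<in> carrier A" "h \<in> carrier A" "e \<in> carrier A" and nz: "l \<noteq> 0" "m \<noteq> 0"
    and inv: "g \<otimes> h = \<one>" "h \<otimes> g = \<one>"
    and e: "e = \<one> \<ominus> inverse (- m) \<odot> (g \<ominus> h)"
    and R1: "e \<otimes> g = inverse l \<odot> e"
  shows "is_bmw_triple l m g h e"
proof -
  have "e \<otimes> g = g \<otimes> e" unfolding e by (simp add: alg_simps inv)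
  moreover have "m \<odot> e = m \<odot> \<one> \<oplus> (g \<ominus> h)"
    unfolding e using nz by (simp add: alg_simps uminus_smult minus_add)
  then have "h = g \<oplus> m \<odot> \<one> \<ominus> m \<odot> e"
    by (simp add: minus_eq minus_add a_ac r_neg r_neg1 r_neg2)
  ultimately show ?thesis using nz R1 inv by (simp add: is_bmw_triple_def)
qed

end

section \<open>Identities at a single node\<close>

locale bmw_triple = assoc_algebra A for A :: "('k::field, 'a, 'm) module_scheme" (structure) +
  fixes l m :: 'k and g h e :: 'a
  assumes triple: "is_bmw_triple l m g h e"
begin

lemma closed [simp]: "g \<in> carrier A" "h \<in> carrier A" "e \<in> carrier A"
  and nonzero [simp]: "l \<noteq> 0" "m \<noteq> 0"
  and g_h [simp]: "g \<otimes> h = \<one>" and h_g [simp]: "h \<otimes> g = \<one>"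
  and h_eq: "h = g \<oplus> m \<odot> \<one> \<ominus> m \<odot> e"
  and g_e: "g \<otimes> e = inverse l \<odot> e" and e_g: "e \<otimes> g = inverse l \<odot> e"
  using triple unfolding is_bmw_triple_def by blast+

lemma cancel [simp]:
  assumes "a \<in> carrier A"
  shows "g \<otimes> (h \<otimes> a) = a" "h \<otimes> (g \<otimes> a) = a"
  using assms by (simp_all flip: m_assoc)

lemma m_smult_e: "m \<odot> e = g \<oplus> m \<odot> \<one> \<ominus> h"
proof -
  have "g \<oplus> m \<odot> \<one> \<ominus> (g \<oplus> m \<odot> \<one> \<ominus> m \<odot> e) = m \<odot> e"
    by (simp add: minus_eq minus_add a_ac r_neg r_neg1 r_neg2)
  then show ?thesis by (simp flip: h_eq)
qed

lemma e_eq: "e = \<one> \<ominus> inverse (- m) \<odot> (g \<ominus> h)"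
proof (rule smult_cancel)
  show "m \<odot> e = m \<odot> (\<one> \<ominus> inverse (- m) \<odot> (g \<ominus> h))"
    unfolding m_smult_e by (simp add: alg_simps uminus_smult minus_add a_ac)
qed simp_all

text \<open>Multiplying \<open>m_smult_e\<close> by \<open>g\<close> on the right turns
  \<open>h\<close> into 1 and \<open>e\<close> into l^-1 e.\<close>

lemma D1: "m \<odot> e = l \<odot> (g \<otimes> g \<oplus> m \<odot> g \<ominus> \<one>)"
proof -
  have "(m * inverse l) \<odot> e = (m \<odot> e) \<otimes> g" by (simp add: smult_mult_left e_g smult_assoc)
  also have "\<dots> = g \<otimes> g \<oplus> m \<odot> g \<ominus> \<one>" unfolding m_smult_e by (simp add: alg_simps)
  finally have "l \<odot> (g \<otimes> g \<oplus> m \<odot> g \<ominus> \<one>) = l \<odot> ((m * inverse l) \<odot> e)" by simp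
  then show ?thesis by (simp add: smult_assoc mult.left_commute[of l m])
qed

lemma h_e: "h \<otimes> e = l \<odot> e"
proof -
  have "e = h \<otimes> (g \<otimes> e)" by simp
  also have "\<dots> = inverse l \<odot> (h \<otimes> e)" unfolding g_e by (simp add: smult_mult_right)
  finally have "l \<odot> e = l \<odot> (inverse l \<odot> (h \<otimes> e))" by simp
  then show ?thesis by (simp add: smult_assoc)
qed

lemma e_h: "e \<otimes> h = l \<odot> e"
proof -
  have "e = (e \<otimes> g) \<otimes> h" by (simp add: m_assoc)
  also have "\<dots> = inverse l \<odot> (e \<otimes> h)" unfolding e_g by (simp add: smult_mult_left)
  finally have "l \<odot> e = l \<odot> (inverse l \<odot> (e \<otimes> h))" by simp
  then show ?thesis by (simp add: smult_assoc)
qed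

text \<open>Each of \<open>g\<close>, 1 and \<open>h\<close> acts on \<open>e\<close> by a scalar,
  hence so does \<open>m \<odot> e\<close>; keeping m on the left avoids fractions.\<close>

lemma m_smult_e_e: "m \<odot> (e \<otimes> e) = (inverse l + m - l) \<odot> e"
proof -
  have "m \<odot> (e \<otimes> e) = (m \<odot> e) \<otimes> e" by (simp add: smult_mult_left)
  also have "\<dots> = inverse l \<odot> e \<oplus> m \<odot> e \<ominus> l \<odot> e"
    by (subst m_smult_e) (simp add: alg_simps g_e h_e)
  also have "\<dots> = (inverse l + m + (- l)) \<odot> e"
    by (simp only: smult_l_distr uminus_smult minus_eq closed)
  finally show ?thesis by simp
qed

end

text \<open>Two adjacent nodes. Relation (R2) is left to the individual lemmas, since the two
  presentations supply different instances of it.\<close>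

locale bmw_braid = i: bmw_triple A l m g h e + j: bmw_triple A l m k h' f
  for A :: "('k::field, 'a, 'm) module_scheme" (structure) and l m g h e k h' f +
  assumes braid: "g \<otimes> k \<otimes> g = k \<otimes> g \<otimes> k"
begin

lemma bmw_braid_swap: "bmw_braid A l m k h' f g h e"
  using braid by unfold_locales simp

text \<open>The braid relation says that conjugation by \<open>g \<otimes> k\<close> carries
  \<open>g\<close> to \<open>k\<close>. Therefore it carries \<open>h\<close> to \<open>h'\<close>,
  and by \<open>m_smult_e\<close> also \<open>m \<odot> e\<close> to
  \<open>m \<odot> f\<close>.\<close>

lemma conj_e: "g \<otimes> k \<otimes> e = f \<otimes> g \<otimes> k"
proof (rule i.smult_cancel)
  have *: "g \<otimes> (k \<otimes> g) = k \<otimes> (g \<otimes> k)"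
    using braid by (simp add: i.m_assoc)
  have "g \<otimes> (k \<otimes> h) = h' \<otimes> (k \<otimes> (g \<otimes> (k \<otimes> h)))" by simp
  also have "\<dots> = h' \<otimes> ((k \<otimes> (g \<otimes> k)) \<otimes> h)" by (simp add: i.m_assoc)
  also have "\<dots> = h' \<otimes> (g \<otimes> k)" unfolding *[symmetric] by (simp add: i.m_assoc)
  finally have **: "g \<otimes> (k \<otimes> h) = h' \<otimes> (g \<otimes> k)" .
  have "m \<odot> (g \<otimes> k \<otimes> e) = g \<otimes> k \<otimes> (m \<odot> e)" by (simp add: i.smult_mult_right)
  also have "\<dots> = (m \<odot> f) \<otimes> g \<otimes> k"
    unfolding i.m_smult_e j.m_smult_e by (simp add: i.alg_simps * **)
  also have "\<dots> = m \<odot> (f \<otimes> g \<otimes> k)" by (simp add: i.smult_mult_left)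
  finally show "m \<odot> (g \<otimes> k \<otimes> e) = m \<odot> (f \<otimes> g \<otimes> k)" .
qed simp_all

lemma conj_f: "k \<otimes> g \<otimes> f = e \<otimes> k \<otimes> g"
  by (rule bmw_braid.conj_e[OF bmw_braid_swap])

text \<open>With D = g k g one has D f = e D and D g = k D. So D (f g f) = (e k e) D, and the
  assumption is transported by cancelling D on the right.\<close>

lemma e_k_e_of_f_g_f:
  assumes "f \<otimes> g \<otimes> f = l \<odot> f"
  shows "e \<otimes> k \<otimes> e = l \<odot> e"
proof -
  define D where "D = g \<otimes> k \<otimes> g"
  define D' where "D' = h \<otimes> h' \<otimes> h"
  have [simp]: "D \<in> carrier A" "D' \<in> carrier A" by (simp_all add: D_def D'_def)
  have inv: "D \<otimes> D' = \<one>" by (simp add: D_def D'_def i.m_assoc)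
  \<comment> \<open>\<open>conj_f\<close> replaces k g f by e k g, and \<open>g\<close> commutes
    with \<open>e\<close> because both products equal l^-1 e.\<close>
  have "D \<otimes> f = g \<otimes> (k \<otimes> g \<otimes> f)" by (simp add: D_def i.m_assoc)
  also have "\<dots> = (g \<otimes> e) \<otimes> (k \<otimes> g)" unfolding conj_f by (simp add: i.m_assoc)
  also have "\<dots> = e \<otimes> D" unfolding i.g_e i.e_g[symmetric] by (simp add: D_def i.m_assoc)
  finally have Df: "D \<otimes> f = e \<otimes> D" .
  have "D \<otimes> g = (k \<otimes> g \<otimes> k) \<otimes> g" by (simp only: D_def braid)
  then have Dg: "D \<otimes> g = k \<otimes> D" by (simp add: D_def i.m_assoc)
  have "(e \<otimes> k \<otimes> e) \<otimes> D = e \<otimes> k \<otimes> (D \<otimes> f)" by (simp add: Df i.m_assoc)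
  also have "\<dots> = e \<otimes> (D \<otimes> g) \<otimes> f" by (simp add: Dg i.m_assoc)
  also have "\<dots> = (D \<otimes> f) \<otimes> g \<otimes> f" by (simp add: Df i.m_assoc)
  also have "\<dots> = D \<otimes> (f \<otimes> g \<otimes> f)" by (simp add: i.m_assoc)
  also have "\<dots> = l \<odot> (D \<otimes> f)" by (simp add: assms i.smult_mult_right)
  also have "\<dots> = (l \<odot> e) \<otimes> D" by (simp add: Df i.smult_mult_left)
  finally show ?thesis by (rule i.right_inverse_cancel[OF inv]) simp_all
qed

text \<open>Supplies the relation with an inverse generator, which \<open>BMW_rels\<close> contains
  and \<open>B_rels\<close> does not.\<close>

lemma e_h'_e:
  assumes R2: "e \<otimes> k \<otimes> e = l \<odot> e" and nz: "1 + l * m \<noteq> 0"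
  shows "e \<otimes> h' \<otimes> e = inverse l \<odot> e"
proof -
  define w where "w = e \<otimes> h' \<otimes> e"
  have [simp]: "w \<in> carrier A" by (simp add: w_def)
  \<comment> \<open>The factor l^-1 from g e = l^-1 e cancels the factor l from (R2). The result
    expresses f e through inverses, and thus e f e through \<open>w\<close>.\<close>
  have "k \<otimes> (g \<otimes> (f \<otimes> e)) = (k \<otimes> g \<otimes> f) \<otimes> e" by (simp add: i.m_assoc)
  also have "\<dots> = e \<otimes> k \<otimes> (g \<otimes> e)" unfolding conj_f by (simp add: i.m_assoc)
  also have "\<dots> = e" by (simp add: i.g_e i.smult_mult_right R2 i.smult_assoc)
  finally have "k \<otimes> (g \<otimes> (f \<otimes> e)) = e" .
  then have "f \<otimes> e = h \<otimes> (h' \<otimes> e)"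
    by (metis i.cancel(2) j.cancel(2) i.closed j.closed i.m_closed)
  then have "e \<otimes> f \<otimes> e = (e \<otimes> h) \<otimes> (h' \<otimes> e)" by (simp add: i.m_assoc)
  then have efe: "e \<otimes> f \<otimes> e = l \<odot> w"
    by (simp add: i.e_h i.smult_mult_left w_def i.m_assoc)
  \<comment> \<open>Inserting h' = k + m - m f into \<open>w\<close> gives a linear equation for
    \<open>w\<close>, because e f e = l w.\<close>
  have "w = e \<otimes> k \<otimes> e \<oplus> m \<odot> (e \<otimes> e) \<ominus> m \<odot> (e \<otimes> f \<otimes> e)"
    unfolding w_def by (subst j.h_eq) (simp add: i.alg_simps)
  also have "\<dots> = l \<odot> e \<oplus> (inverse l + m - l) \<odot> e \<ominus> (m * l) \<odot> w"
    by (simp add: R2 i.m_smult_e_e efe i.smult_assoc)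
  also have "\<dots> = (inverse l + m) \<odot> e \<ominus> (m * l) \<odot> w"
    by (simp flip: i.smult_l_distr)
  finally have "w \<oplus> (m * l) \<odot> w = (inverse l + m) \<odot> e"
    by (metis i.closed i.smult_closed i.minus_closed i.add.inv_solve_right' i.minus_eq \<open>w \<in> carrier A\<close>)
  then have "(1 + l * m) \<odot> w = (inverse l + m) \<odot> e"
    by (simp add: i.smult_l_distr mult.commute)
  also have "\<dots> = (1 + l * m) \<odot> (inverse l \<odot> e)"
    by (simp add: i.smult_assoc field_simps)
  finally show ?thesis using nz unfolding w_def by (rule i.smult_cancel) simp_all
qed

end

section \<open>Semilinear homomorphisms and quotients\<close>

text \<open>The two algebras have different base fields, so maps out of B(M) are linear only along
  \<theta>. Taking \<theta> to be the identity gives ordinary algebra homomorphisms.\<close>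

locale semilinear_hom =
  A: assoc_algebra A + B: assoc_algebra B + scalar: scalar_hom \<theta>
  for A :: "('k::field, 'a, 'm) module_scheme" and B :: "('K::field, 'b, 'n) module_scheme"
    and \<theta> :: "'k \<Rightarrow> 'K" and h :: "'a \<Rightarrow> 'b" +
  assumes ring_hom: "h \<in> ring_hom A B"
    and hom_smult [simp]: "a \<in> carrier A \<Longrightarrow> h (c \<odot>\<^bsub>A\<^esub> a) = \<theta> c \<odot>\<^bsub>B\<^esub> h a"
begin

sublocale ring_hom: ring_hom_ring A B h
  by (intro ring_hom_ringI2 A.ring_axioms B.ring_axioms ring_hom)

lemma hom_minus [simp]:
  assumes "a \<in> carrier A" "b \<in> carrier A"
  shows "h (a \<ominus>\<^bsub>A\<^esub> b) = h a \<ominus>\<^bsub>B\<^esub> h b"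
  using assms by (simp add: A.minus_eq B.minus_eq)

lemma vanishes_on_genideal:
  assumes "S \<subseteq> carrier A" and "\<And>s. s \<in> S \<Longrightarrow> h s = \<zero>\<^bsub>B\<^esub>" and "a \<in> Idl\<^bsub>A\<^esub> S"
  shows "h a = \<zero>\<^bsub>B\<^esub>"
proof -
  have "S \<subseteq> a_kernel A B h"
    unfolding a_kernel_def' using assms(1,2) by blast
  then have "Idl\<^bsub>A\<^esub> S \<subseteq> a_kernel A B h"
    by (rule A.genideal_minimal[OF ring_hom.kernel_is_ideal])
  then show ?thesis using assms(3) unfolding a_kernel_def' by blast
qed

end

lemma semilinear_hom_comp:
  assumes "semilinear_hom A B \<theta> h" and "semilinear_hom B C \<tau> k"
  shows "semilinear_hom A C (\<lambda>c. \<tau> (\<theta> c)) (\<lambda>a. k (h a))"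
proof -
  interpret h: semilinear_hom A B \<theta> h by fact
  interpret k: semilinear_hom B C \<tau> k by fact
  show ?thesis
  proof
    show "(\<lambda>a. k (h a)) \<in> ring_hom A C"
      by (rule ring_hom_memI) simp_all
  qed (simp_all add: h.scalar.add h.scalar.mult h.scalar.one k.scalar.add k.scalar.mult k.scalar.one)
qed

section \<open>Quotients by two-sided ideals\<close>

context assoc_algebra
begin

context
  fixes I
  assumes I: "ideal I A"
begin

interpretation I: ideal I A by (rule I)

lemma quotient_class_eq_iff:
  assumes "a \<in> carrier A" "b \<in> carrier A"
  shows "I +> a = I +> b \<longleftrightarrow> a \<ominus> b \<in> I"
  using quotient_eq_iff_same_a_r_cos[OF I assms] by simp

text \<open>\<open>quotient_algebra\<close> defines the scalar action as a union over all
  representatives. They give one and the same coset, because the ideal is closed under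
  multiplication by \<open>c \<odot> \<one>\<close>.\<close>

lemma quotient_smult_class:
  assumes a: "a \<in> carrier A"
  shows "c \<odot>\<^bsub>quotient_algebra A I\<^esub> (I +> a) = I +> c \<odot> a"
proof -
  have "I +> c \<odot> x = I +> c \<odot> a" if x: "x \<in> I +> a" for x
  proof -
    obtain y where y: "y \<in> I" "x = y \<oplus> a"
      using x by (auto simp: a_r_coset_def r_coset_def)
    have xc: "x \<in> carrier A" using y a I.a_Hcarr by simp
    have "x \<ominus> a \<in> I" using y a I.a_Hcarr by (simp add: minus_eq a_assoc r_neg)
    then have "(c \<odot> \<one>) \<otimes> (x \<ominus> a) \<in> I" by (simp add: I.I_l_closed)
    then have "c \<odot> x \<ominus> c \<odot> a \<in> I" using a xc by (simp add: alg_simps)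
    then show ?thesis using a xc by (simp add: quotient_class_eq_iff)
  qed
  then have "(\<Union>x\<in>I +> a. I +> c \<odot> x) = (\<Union>x\<in>I +> a. I +> c \<odot> a)"
    by (rule SUP_cong[OF refl])
  also have "\<dots> = I +> c \<odot> a"
    using I.a_rcos_self[OF a] by (intro UN_constant_eq) auto
  finally show ?thesis by (simp add: quotient_algebra_def ring.defs module.defs)
qed

lemma quotient_carrier: "carrier (quotient_algebra A I) = (\<lambda>a. I +> a) ` carrier A"
  by (auto simp: quotient_algebra_def ring.defs FactRing_simps)

lemma ring_quotient_algebra: "ring (quotient_algebra A I)"
proof -
  interpret R: ring "A Quot I" by (rule I.quotient_is_ring)
  show ?thesis
  proof (intro ringI abelian_groupI monoidI)
    fix a assume "a \<in> carrier (quotient_algebra A I)"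
    then show "\<exists>b\<in>carrier (quotient_algebra A I).
        b \<oplus>\<^bsub>quotient_algebra A I\<^esub> a = \<zero>\<^bsub>quotient_algebra A I\<^esub>"
      by (intro bexI[of _ "\<ominus>\<^bsub>A Quot I\<^esub> a"])
        (simp_all add: quotient_algebra_def ring.defs R.l_neg)
  qed (simp_all add: quotient_algebra_def ring.defs R.a_ac R.m_assoc R.l_distr R.r_distr)
qed

lemma quotient_class_ring_hom: "(\<lambda>a. I +> a) \<in> ring_hom A (quotient_algebra A I)"
  using I.rcos_ring_hom by (simp add: ring_hom_def quotient_algebra_def ring.defs)

lemma assoc_algebra_quotient: "assoc_algebra (quotient_algebra A I)"
proof -
  let ?Q = "quotient_algebra A I"
  interpret Q: ring ?Q by (rule ring_quotient_algebra)
  interpret c: ring_hom_ring A ?Q "\<lambda>a. I +> a"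
    by (intro ring_hom_ringI2 ring_axioms Q.ring_axioms quotient_class_ring_hom)
  show ?thesis
    by unfold_locales
      (auto simp: quotient_carrier quotient_smult_class alg_simps smult_l_distr
        simp flip: c.hom_add c.hom_mult)
qed

lemma quotient_class_hom: "semilinear_hom A (quotient_algebra A I) (\<lambda>c. c) (\<lambda>a. I +> a)"
  by (intro semilinear_hom.intro semilinear_hom_axioms.intro assoc_algebra_axioms
      assoc_algebra_quotient scalar_hom_id quotient_class_ring_hom)
    (simp add: quotient_smult_class)

end

lemma quotient_lift:
  assumes h: "semilinear_hom A D \<theta> h" and S: "S \<subseteq> carrier A"
    and zero: "\<And>s. s \<in> S \<Longrightarrow> h s = \<zero>\<^bsub>D\<^esub>"
  shows "\<exists>k. semilinear_hom (quotient_algebra A (Idl S)) D \<theta> k \<and>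
             (\<forall>a\<in>carrier A. k (Idl S +> a) = h a)"
proof -
  interpret h: semilinear_hom A D \<theta> h by fact
  have I: "ideal (Idl S) A" by (rule genideal_ideal[OF S])
  let ?Q = "quotient_algebra A (Idl S)"
  interpret c: semilinear_hom A ?Q "\<lambda>c. c" "\<lambda>a. Idl S +> a" by (rule quotient_class_hom[OF I])
  have eq: "h a = h b" if "Idl S +> a = Idl S +> b" "a \<in> carrier A" "b \<in> carrier A" for a b
  proof -
    have "h (a \<ominus> b) = \<zero>\<^bsub>D\<^esub>"
      using that quotient_class_eq_iff[OF I] h.vanishes_on_genideal[OF S zero] by blast
    then show ?thesis using that by simp
  qed
  \<comment> \<open>The value is read off at an arbitrary representative; \<open>eq\<close> makes
    the choice immaterial.\<close>
  define k where "k Y = h (SOME a. a \<in> carrier A \<and> Idl S +> a = Y)" for Y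
  have k: "k (Idl S +> a) = h a" if "a \<in> carrier A" for a
  proof -
    have "\<exists>b. b \<in> carrier A \<and> Idl S +> b = Idl S +> a" using that by blast
    from someI_ex[OF this] show ?thesis unfolding k_def using that eq by blast
  qed
  have "k \<in> ring_hom ?Q D"
    by (rule ring_hom_memI)
      (auto simp: quotient_carrier[OF I] k simp flip: c.ring_hom.hom_add c.ring_hom.hom_mult c.ring_hom.hom_one)
  then have "semilinear_hom ?Q D \<theta> k"
    by (intro semilinear_hom.intro semilinear_hom_axioms.intro assoc_algebra_quotient[OF I]
        h.B.assoc_algebra_axioms h.scalar.scalar_hom_axioms)
      (auto simp: quotient_carrier[OF I] k simp flip: c.hom_smult)
  then show ?thesis using k by blast
qed

end

section \<open>Monoid algebras\<close>

lemma monoid_algebra_simps [simp]: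
  "carrier (monoid_algebra M) = {f. Poly_Mapping.keys f \<subseteq> carrier M}"
  "\<one>\<^bsub>monoid_algebra M\<^esub> = Poly_Mapping.single \<one>\<^bsub>M\<^esub> 1"
  "\<zero>\<^bsub>monoid_algebra M\<^esub> = 0"
  "f \<oplus>\<^bsub>monoid_algebra M\<^esub> g = f + g"
  "c \<odot>\<^bsub>monoid_algebra M\<^esub> f = Poly_Mapping.map ((*) c) f"
  by (simp_all add: monoid_algebra_def)

lemma lookup_map_times:
  "Poly_Mapping.lookup (Poly_Mapping.map ((*) c) f) u = c * Poly_Mapping.lookup f u"
  for f :: "'b \<Rightarrow>\<^sub>0 'k::field"
  by (simp add: map.rep_eq when_def)

text \<open>The support of a sum can be smaller than the union of the supports. Summing over a
  common finite superset makes distributivity a termwise computation.\<close>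

lemma monoid_algebra_mult_superset:
  fixes f g :: "'a \<Rightarrow>\<^sub>0 'k::field"
  assumes "finite S" "finite T" "Poly_Mapping.keys f \<subseteq> S" "Poly_Mapping.keys g \<subseteq> T"
  shows "f \<otimes>\<^bsub>monoid_algebra M\<^esub> g = (\<Sum>u\<in>S. \<Sum>v\<in>T.
    Poly_Mapping.single (u \<otimes>\<^bsub>M\<^esub> v) (Poly_Mapping.lookup f u * Poly_Mapping.lookup g v))"
proof -
  have "f \<otimes>\<^bsub>monoid_algebra M\<^esub> g = (\<Sum>u\<in>Poly_Mapping.keys f. \<Sum>v\<in>T.
    Poly_Mapping.single (u \<otimes>\<^bsub>M\<^esub> v) (Poly_Mapping.lookup f u * Poly_Mapping.lookup g v))"
    unfolding monoid_algebra_def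
    by simp (intro sum.cong refl sum.mono_neutral_left; use assms in \<open>auto simp: in_keys_iff\<close>)
  also have "\<dots> = (\<Sum>u\<in>S. \<Sum>v\<in>T.
    Poly_Mapping.single (u \<otimes>\<^bsub>M\<^esub> v) (Poly_Mapping.lookup f u * Poly_Mapping.lookup g v))"
    by (rule sum.mono_neutral_left) (auto simp: assms in_keys_iff)
  finally show ?thesis .
qed

lemma monoid_algebra_mult_single:
  fixes c d :: "'k::field"
  shows "Poly_Mapping.single u c \<otimes>\<^bsub>monoid_algebra M\<^esub> Poly_Mapping.single v d
    = Poly_Mapping.single (u \<otimes>\<^bsub>M\<^esub> v) (c * d)"
  by (subst monoid_algebra_mult_superset[of "{u}" "{v}"]) simp_all

lemma monoid_algebra_mult_add_left:
  fixes f g k :: "'a \<Rightarrow>\<^sub>0 'k::field"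
  shows "(f + g) \<otimes>\<^bsub>monoid_algebra M\<^esub> k = f \<otimes>\<^bsub>monoid_algebra M\<^esub> k + g \<otimes>\<^bsub>monoid_algebra M\<^esub> k"
proof -
  let ?S = "Poly_Mapping.keys f \<union> Poly_Mapping.keys g"
  have S: "finite ?S" "Poly_Mapping.keys (f + g) \<subseteq> ?S" by (simp_all add: Poly_Mapping.keys_add)
  note sup = monoid_algebra_mult_superset[where S = ?S and T = "Poly_Mapping.keys k" and g = k]
  show ?thesis
    using S by (simp add: sup lookup_add distrib_right single_add sum.distrib)
qed

lemma monoid_algebra_mult_add_right:
  fixes f g k :: "'a \<Rightarrow>\<^sub>0 'k::field"
  shows "k \<otimes>\<^bsub>monoid_algebra M\<^esub> (f + g) = k \<otimes>\<^bsub>monoid_algebra M\<^esub> f + k \<otimes>\<^bsub>monoid_algebra M\<^esub> g"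
proof -
  let ?S = "Poly_Mapping.keys f \<union> Poly_Mapping.keys g"
  have S: "finite ?S" "Poly_Mapping.keys (f + g) \<subseteq> ?S" by (simp_all add: Poly_Mapping.keys_add)
  note sup = monoid_algebra_mult_superset[where T = ?S and S = "Poly_Mapping.keys k" and f = k]
  show ?thesis
    using S by (simp add: sup lookup_add distrib_left single_add sum.distrib)
qed

lemma monoid_algebra_mult_zero:
  fixes f :: "'a \<Rightarrow>\<^sub>0 'k::field"
  shows "0 \<otimes>\<^bsub>monoid_algebra M\<^esub> f = 0" "f \<otimes>\<^bsub>monoid_algebra M\<^esub> 0 = 0"
  by (simp_all add: monoid_algebra_def)

lemma map_times_add:
  fixes f g :: "'a \<Rightarrow>\<^sub>0 'k::field"
  shows "Poly_Mapping.map ((*) c) (f + g) = Poly_Mapping.map ((*) c) f + Poly_Mapping.map ((*) c) g"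
  by (rule poly_mapping_eqI) (simp add: lookup_map_times lookup_add distrib_left)

lemma map_times_single:
  fixes c d :: "'k::field"
  shows "Poly_Mapping.map ((*) c) (Poly_Mapping.single u d) = Poly_Mapping.single u (c * d)"
  by (rule poly_mapping_eqI) (simp add: lookup_map_times lookup_single when_def)

lemma keys_map_times_subset:
  fixes f :: "'a \<Rightarrow>\<^sub>0 'k::field"
  assumes "Poly_Mapping.keys f \<subseteq> C"
  shows "Poly_Mapping.keys (Poly_Mapping.map ((*) c) f) \<subseteq> C"
  using assms by (auto simp: in_keys_iff lookup_map_times subset_iff)

lemma keys_add_subset:
  assumes "Poly_Mapping.keys f \<subseteq> C" "Poly_Mapping.keys g \<subseteq> C"
  shows "Poly_Mapping.keys (f + g) \<subseteq> C"
  using Poly_Mapping.keys_add[of f g] assms by blast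

text \<open>Every element is a finite sum of monomials, so identities that are additive in each
  argument need only be checked on monomials.\<close>

lemma monoid_algebra_induct [consumes 1, case_names zero single add]:
  fixes f :: "'a \<Rightarrow>\<^sub>0 'k::field"
  assumes "Poly_Mapping.keys f \<subseteq> C"
    and zero: "P 0"
    and single: "\<And>u c. u \<in> C \<Longrightarrow> P (Poly_Mapping.single u c)"
    and add: "\<And>f g. Poly_Mapping.keys f \<subseteq> C \<Longrightarrow> Poly_Mapping.keys g \<subseteq> C \<Longrightarrow>
      P f \<Longrightarrow> P g \<Longrightarrow> P (f + g)"
  shows "P f"
proof -
  \<comment> \<open>The induction runs over a finite set containing the support, so that the case
    where \<open>u\<close> lies outside the support of \<open>f\<close> is covered too: the monomial
    split off is then 0.\<close>
  have "P f" if "finite S" "Poly_Mapping.keys f \<subseteq> S" "S \<subseteq> C" for S f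
    using that
  proof (induction S arbitrary: f rule: finite_induct)
    case empty
    then show ?case using zero by simp
  next
    case (insert u S)
    let ?s = "Poly_Mapping.single u (Poly_Mapping.lookup f u)"
    have k: "Poly_Mapping.keys (f - ?s) \<subseteq> S"
    proof
      fix v assume "v \<in> Poly_Mapping.keys (f - ?s)"
      then have "v \<in> Poly_Mapping.keys f \<and> v \<noteq> u"
        by (auto simp: in_keys_iff lookup_minus lookup_single when_def split: if_splits)
      then show "v \<in> S" using insert.prems by blast
    qed
    then have "P (f - ?s)" using insert by simp
    then have "P (?s + (f - ?s))"
      using insert.prems k by (intro add single) auto
    then show ?case by simp
  qed
  from this[of "Poly_Mapping.keys f" f] assms(1) show ?thesis by simp
qed

context Group.monoid
begin

lemma monoid_algebra_closed:
  fixes f g :: "'a \<Rightarrow>\<^sub>0 'k::field"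
  assumes "Poly_Mapping.keys f \<subseteq> carrier G" "Poly_Mapping.keys g \<subseteq> carrier G"
  shows "Poly_Mapping.keys (f \<otimes>\<^bsub>monoid_algebra G\<^esub> g) \<subseteq> carrier G"
  using assms(1)
proof (induction f rule: monoid_algebra_induct)
  case (single u c)
  show ?case using assms(2)
  proof (induction g rule: monoid_algebra_induct)
    case (add f g)
    then show ?case
      unfolding monoid_algebra_mult_add_right by (intro keys_add_subset)
  qed (use single in \<open>auto simp: monoid_algebra_mult_zero monoid_algebra_mult_single\<close>)
next
  case (add f g)
  then show ?case
    unfolding monoid_algebra_mult_add_left by (intro keys_add_subset)
qed (simp add: monoid_algebra_mult_zero)

lemma monoid_algebra_assoc:
  fixes f g k :: "'a \<Rightarrow>\<^sub>0 'k::field"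
  assumes "Poly_Mapping.keys f \<subseteq> carrier G" "Poly_Mapping.keys g \<subseteq> carrier G"
    "Poly_Mapping.keys k \<subseteq> carrier G"
  shows "f \<otimes>\<^bsub>monoid_algebra G\<^esub> g \<otimes>\<^bsub>monoid_algebra G\<^esub> k
    = f \<otimes>\<^bsub>monoid_algebra G\<^esub> (g \<otimes>\<^bsub>monoid_algebra G\<^esub> k)"
  using assms(1)
proof (induction f rule: monoid_algebra_induct)
  case f: (single u c)
  show ?case using assms(2)
  proof (induction g rule: monoid_algebra_induct)
    case g: (single v d)
    show ?case using assms(3)
    proof (induction k rule: monoid_algebra_induct)
    qed (simp_all add: f g monoid_algebra_mult_zero monoid_algebra_mult_single
        monoid_algebra_mult_add_right m_assoc mult.assoc)
  qed (simp_all add: monoid_algebra_mult_zero monoid_algebra_mult_add_right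
        monoid_algebra_mult_add_left)
qed (simp_all add: monoid_algebra_mult_zero monoid_algebra_mult_add_left)

lemma monoid_algebra_one_mult:
  fixes f :: "'a \<Rightarrow>\<^sub>0 'k::field"
  assumes "Poly_Mapping.keys f \<subseteq> carrier G"
  shows "Poly_Mapping.single \<one> 1 \<otimes>\<^bsub>monoid_algebra G\<^esub> f = f"
    and "f \<otimes>\<^bsub>monoid_algebra G\<^esub> Poly_Mapping.single \<one> 1 = f"
  using assms
  by (induction f rule: monoid_algebra_induct)
    (simp_all add: monoid_algebra_mult_zero monoid_algebra_mult_single
      monoid_algebra_mult_add_left monoid_algebra_mult_add_right)

lemma monoid_algebra_smult_mult:
  fixes f g :: "'a \<Rightarrow>\<^sub>0 'k::field"
  assumes "Poly_Mapping.keys f \<subseteq> carrier G" "Poly_Mapping.keys g \<subseteq> carrier G"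
  shows "Poly_Mapping.map ((*) c) f \<otimes>\<^bsub>monoid_algebra G\<^esub> g
      = Poly_Mapping.map ((*) c) (f \<otimes>\<^bsub>monoid_algebra G\<^esub> g)"
    and "f \<otimes>\<^bsub>monoid_algebra G\<^esub> Poly_Mapping.map ((*) c) g
      = Poly_Mapping.map ((*) c) (f \<otimes>\<^bsub>monoid_algebra G\<^esub> g)"
proof -
  have zero: "Poly_Mapping.map ((*) c) (0 :: 'a \<Rightarrow>\<^sub>0 'k) = 0"
    by (rule poly_mapping_eqI) (simp add: lookup_map_times)
  note simps = monoid_algebra_mult_zero monoid_algebra_mult_single map_times_single map_times_add
    monoid_algebra_mult_add_left monoid_algebra_mult_add_right zero
  have *: "Poly_Mapping.map ((*) c) f \<otimes>\<^bsub>monoid_algebra G\<^esub> g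
        = Poly_Mapping.map ((*) c) (f \<otimes>\<^bsub>monoid_algebra G\<^esub> g)
      \<and> f \<otimes>\<^bsub>monoid_algebra G\<^esub> Poly_Mapping.map ((*) c) g
        = Poly_Mapping.map ((*) c) (f \<otimes>\<^bsub>monoid_algebra G\<^esub> g)"
    using assms(1)
  proof (induction f rule: monoid_algebra_induct)
    case (single u d)
    show ?case using assms(2)
      by (induction g rule: monoid_algebra_induct) (simp_all add: simps mult.assoc mult.left_commute)
  qed (simp_all add: simps)
  then show "Poly_Mapping.map ((*) c) f \<otimes>\<^bsub>monoid_algebra G\<^esub> g
      = Poly_Mapping.map ((*) c) (f \<otimes>\<^bsub>monoid_algebra G\<^esub> g)"
    and "f \<otimes>\<^bsub>monoid_algebra G\<^esub> Poly_Mapping.map ((*) c) g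
      = Poly_Mapping.map ((*) c) (f \<otimes>\<^bsub>monoid_algebra G\<^esub> g)" by simp_all
qed

lemma assoc_algebra_monoid_algebra:
  "assoc_algebra (monoid_algebra G :: ('k::field, 'a \<Rightarrow>\<^sub>0 'k) module)"
proof -
  have "ring (monoid_algebra G :: ('k, 'a \<Rightarrow>\<^sub>0 'k) module)"
  proof (intro ringI abelian_groupI monoidI)
    fix f :: "'a \<Rightarrow>\<^sub>0 'k" assume "f \<in> carrier (monoid_algebra G)"
    then show "\<exists>g\<in>carrier (monoid_algebra G). g \<oplus>\<^bsub>monoid_algebra G\<^esub> f = \<zero>\<^bsub>monoid_algebra G\<^esub>"
      by (intro bexI[of _ "- f"]) simp_all
  qed (auto simp: keys_add_subset ac_simps monoid_algebra_closed monoid_algebra_assoc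
      monoid_algebra_one_mult monoid_algebra_mult_add_left monoid_algebra_mult_add_right)
  then show ?thesis
  proof (intro assoc_algebra.intro assoc_algebra_axioms.intro)
    fix c d :: 'k and f :: "'a \<Rightarrow>\<^sub>0 'k"
    show "(c + d) \<odot>\<^bsub>monoid_algebra G\<^esub> f
        = c \<odot>\<^bsub>monoid_algebra G\<^esub> f \<oplus>\<^bsub>monoid_algebra G\<^esub> d \<odot>\<^bsub>monoid_algebra G\<^esub> f"
      by (rule poly_mapping_eqI) (simp add: lookup_map_times lookup_add distrib_right)
    show "c \<odot>\<^bsub>monoid_algebra G\<^esub> (d \<odot>\<^bsub>monoid_algebra G\<^esub> f) = (c * d) \<odot>\<^bsub>monoid_algebra G\<^esub> f"
      by (rule poly_mapping_eqI) (simp add: lookup_map_times mult.assoc)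
    show "1 \<odot>\<^bsub>monoid_algebra G\<^esub> f = f"
      by (rule poly_mapping_eqI) (simp add: lookup_map_times)
  qed (simp_all add: keys_map_times_subset map_times_add monoid_algebra_smult_mult)
qed

end

section \<open>The universal property of the monoid algebra\<close>

definition monoid_algebra_lift ::
    "('k::field \<Rightarrow> 'K) \<Rightarrow> ('K, 'b, 'n) module_scheme \<Rightarrow> ('a \<Rightarrow> 'b) \<Rightarrow> ('a \<Rightarrow>\<^sub>0 'k) \<Rightarrow> 'b" where
  "monoid_algebra_lift \<theta> D f p =
    (\<Oplus>\<^bsub>D\<^esub>u\<in>Poly_Mapping.keys p. \<theta> (Poly_Mapping.lookup p u) \<odot>\<^bsub>D\<^esub> f u)"

text \<open>\<open>f\<close> is a homomorphism into the multiplicative monoid of \<open>D\<close>.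
  The locale serves twice: with the free monoid it yields maps out of free algebras, and with the
  multiplicative monoid of an algebra it yields maps out of a scalar extension.\<close>

locale monoid_algebra_universal = M: Group.monoid M + D: assoc_algebra D + scalar: scalar_hom \<theta>
  for M :: "('a, 'm) monoid_scheme" and D :: "('K::field, 'b, 'n) module_scheme"
    and \<theta> :: "'k::field \<Rightarrow> 'K" and f :: "'a \<Rightarrow> 'b" +
  assumes f_closed [simp]: "u \<in> carrier M \<Longrightarrow> f u \<in> carrier D"
    and f_mult: "u \<in> carrier M \<Longrightarrow> v \<in> carrier M \<Longrightarrow> f (u \<otimes>\<^bsub>M\<^esub> v) = f u \<otimes>\<^bsub>D\<^esub> f v"
    and f_one: "f \<one>\<^bsub>M\<^esub> = \<one>\<^bsub>D\<^esub>"
begin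

abbreviation "lift \<equiv> monoid_algebra_lift \<theta> D f"

lemma lift_superset:
  assumes "finite S" "Poly_Mapping.keys p \<subseteq> S" "S \<subseteq> carrier M"
  shows "lift p = (\<Oplus>\<^bsub>D\<^esub>u\<in>S. \<theta> (Poly_Mapping.lookup p u) \<odot>\<^bsub>D\<^esub> f u)"
  unfolding monoid_algebra_lift_def
  by (rule D.add.finprod_mono_neutral_cong_left)
    (use assms in \<open>auto simp: in_keys_iff scalar.zero subset_iff\<close>)

lemma lift_zero: "lift 0 = \<zero>\<^bsub>D\<^esub>"
  by (simp add: monoid_algebra_lift_def)

lemma lift_single:
  assumes "u \<in> carrier M"
  shows "lift (Poly_Mapping.single u c) = \<theta> c \<odot>\<^bsub>D\<^esub> f u"
  using assms by (subst lift_superset[of "{u}"]) simp_all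

lemma lift_add:
  assumes "Poly_Mapping.keys p \<subseteq> carrier M" "Poly_Mapping.keys q \<subseteq> carrier M"
  shows "lift (p + q) = lift p \<oplus>\<^bsub>D\<^esub> lift q"
proof -
  let ?S = "Poly_Mapping.keys p \<union> Poly_Mapping.keys q"
  have S: "finite ?S" "Poly_Mapping.keys (p + q) \<subseteq> ?S" "?S \<subseteq> carrier M"
    using assms by (simp_all add: Poly_Mapping.keys_add)
  have "lift (p + q) = (\<Oplus>\<^bsub>D\<^esub>u\<in>?S. \<theta> (Poly_Mapping.lookup p u) \<odot>\<^bsub>D\<^esub> f u
      \<oplus>\<^bsub>D\<^esub> \<theta> (Poly_Mapping.lookup q u) \<odot>\<^bsub>D\<^esub> f u)"
    unfolding lift_superset[OF S] using S(3)
    by (intro D.finsum_cong') (auto simp: lookup_add scalar.add D.smult_l_distr)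
  also have "\<dots> = lift p \<oplus>\<^bsub>D\<^esub> lift q"
    using S(3) by (subst D.finsum_addf) (auto simp: lift_superset[OF S(1) _ S(3)])
  finally show ?thesis .
qed

lemma lift_closed:
  assumes "Poly_Mapping.keys p \<subseteq> carrier M"
  shows "lift p \<in> carrier D"
  unfolding monoid_algebra_lift_def using assms by (intro D.finsum_closed) auto

lemma lift_mult:
  assumes "Poly_Mapping.keys p \<subseteq> carrier M" "Poly_Mapping.keys q \<subseteq> carrier M"
  shows "lift (p \<otimes>\<^bsub>monoid_algebra M\<^esub> q) = lift p \<otimes>\<^bsub>D\<^esub> lift q"
  using assms(1)
proof (induction p rule: monoid_algebra_induct)
  case (single u c)
  show ?case using assms(2)
  proof (induction q rule: monoid_algebra_induct)
    case (single v d)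
    then show ?case using \<open>u \<in> carrier M\<close>
      by (simp add: monoid_algebra_mult_single lift_single f_mult scalar.mult D.alg_simps mult.commute)
  qed (simp_all add: single lift_zero monoid_algebra_mult_zero monoid_algebra_mult_add_right
      lift_add M.monoid_algebra_closed D.r_distr lift_closed)
qed (simp_all add: assms(2) lift_zero monoid_algebra_mult_zero monoid_algebra_mult_add_left
      lift_add M.monoid_algebra_closed D.l_distr lift_closed)

lemma lift_smult:
  assumes "Poly_Mapping.keys p \<subseteq> carrier M"
  shows "lift (Poly_Mapping.map ((*) c) p) = \<theta> c \<odot>\<^bsub>D\<^esub> lift p"
  using assms
proof (induction p rule: monoid_algebra_induct)
  case zero
  have "Poly_Mapping.map ((*) c) (0 :: 'a \<Rightarrow>\<^sub>0 'k) = 0"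
    by (rule poly_mapping_eqI) (simp add: lookup_map_times)
  then show ?case by (simp add: lift_zero)
next
  case (add p q)
  then have "Poly_Mapping.keys (Poly_Mapping.map ((*) c) p) \<subseteq> carrier M"
    "Poly_Mapping.keys (Poly_Mapping.map ((*) c) q) \<subseteq> carrier M"
    by (simp_all add: keys_map_times_subset)
  then show ?case using add by (simp add: map_times_add lift_add lift_closed D.smult_r_distr)
qed (simp add: map_times_single lift_single D.smult_assoc scalar.mult)

lemma semilinear_hom_lift: "semilinear_hom (monoid_algebra M) D \<theta> lift"
proof (intro semilinear_hom.intro semilinear_hom_axioms.intro M.assoc_algebra_monoid_algebra
    D.assoc_algebra_axioms scalar.scalar_hom_axioms)
  show "lift \<in> ring_hom (monoid_algebra M) D"
    by (rule ring_hom_memI)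
      (simp_all add: lift_closed lift_mult lift_add lift_single scalar.one f_one)
qed (simp add: lift_smult)

end

lemma monoid_algebra_hom_unique:
  assumes h: "semilinear_hom (monoid_algebra M :: ('k::field, 'a \<Rightarrow>\<^sub>0 'k) module) D \<theta> h"
    and k: "semilinear_hom (monoid_algebra M) D \<theta> k"
    and eq: "\<And>u. u \<in> carrier M \<Longrightarrow> h (Poly_Mapping.single u 1) = k (Poly_Mapping.single u 1)"
    and p: "p \<in> carrier (monoid_algebra M)"
  shows "h p = k p"
proof -
  interpret h: semilinear_hom "monoid_algebra M" D \<theta> h by fact
  interpret k: semilinear_hom "monoid_algebra M" D \<theta> k by fact
  have "Poly_Mapping.keys p \<subseteq> carrier M" using p by simp
  then show ?thesis
  proof (induction p rule: monoid_algebra_induct)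
    case zero
    then show ?case using h.ring_hom.hom_zero k.ring_hom.hom_zero by simp
  next
    case (single u c)
    then have "Poly_Mapping.single u 1 \<in> carrier (monoid_algebra M :: ('k, 'a \<Rightarrow>\<^sub>0 'k) module)"
      by simp
    from h.hom_smult[OF this, of c] k.hom_smult[OF this, of c] show ?case
      by (simp add: map_times_single eq single)
  next
    case (add p q)
    then show ?case using h.ring_hom.hom_add[of p q] k.ring_hom.hom_add[of p q] by simp
  qed
qed

section \<open>Presentations and extension of scalars\<close>

lemma monoid_free_monoid: "Group.monoid (free_monoid V)"
  by (rule Group.monoidI) (auto simp: free_monoid_def)

lemma assoc_algebra_free_algebra: "assoc_algebra (free_algebra V)"
  unfolding free_algebra_def by (rule monoid.assoc_algebra_monoid_algebra[OF monoid_free_monoid])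

lemma var_closed: "v \<in> V \<Longrightarrow> var v \<in> carrier (free_algebra V)"
  by (simp add: free_algebra_def var_def free_monoid_def)

lemma free_algebra_single_Cons:
  "Poly_Mapping.single (v # w) 1 = var v \<otimes>\<^bsub>free_algebra V\<^esub> (Poly_Mapping.single w 1 :: _ \<Rightarrow>\<^sub>0 'k::field)"
  by (simp add: free_algebra_def var_def monoid_algebra_mult_single) (simp add: free_monoid_def)

lemma free_algebra_hom_exists:
  assumes D: "assoc_algebra D" and \<theta>: "scalar_hom \<theta>" and f: "\<And>v. v \<in> V \<Longrightarrow> f v \<in> carrier D"
  shows "\<exists>h. semilinear_hom (free_algebra V) D \<theta> h \<and> (\<forall>v\<in>V. h (var v) = f v)"
proof -
  interpret D: assoc_algebra D by fact
  \<comment> \<open>The multiplicative extension of \<open>f\<close> from letters to words.\<close>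
  define F where "F w = foldr (\<lambda>v a. f v \<otimes>\<^bsub>D\<^esub> a) w \<one>\<^bsub>D\<^esub>" for w
  have F_closed: "F w \<in> carrier D" if "w \<in> lists V" for w
    using that unfolding F_def by (induction w) (simp_all add: f)
  have F_append: "F (u @ w) = F u \<otimes>\<^bsub>D\<^esub> F w" if "u \<in> lists V" "w \<in> lists V" for u w
    using that(1)
  proof (induction u)
    case Nil
    then show ?case using F_closed[OF that(2)] by (simp add: F_def)
  next
    case (Cons v u)
    then show ?case using F_closed[OF that(2)] F_closed[of u] f[of v]
      by (simp add: F_def D.m_assoc)
  qed
  interpret monoid_algebra_universal "free_monoid V" D \<theta> F
    by (intro monoid_algebra_universal.intro monoid_algebra_universal_axioms.intro
        monoid_free_monoid D \<theta>)
      (simp_all add: free_monoid_def F_closed F_append, simp add: F_def)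
  have "lift (var v) = f v" if "v \<in> V" for v
    using that f[OF that] by (simp add: var_def lift_single free_monoid_def scalar.one F_def)
  then show ?thesis using semilinear_hom_lift unfolding free_algebra_def by blast
qed

lemma free_algebra_hom_unique:
  fixes h k :: "('v list \<Rightarrow>\<^sub>0 'k::field) \<Rightarrow> 'b"
  assumes h: "semilinear_hom (free_algebra V) D \<theta> h" and k: "semilinear_hom (free_algebra V) D \<theta> k"
    and eq: "\<And>v. v \<in> V \<Longrightarrow> h (var v) = k (var v)"
    and p: "p \<in> carrier (free_algebra V)"
  shows "h p = k p"
proof (rule monoid_algebra_hom_unique)
  interpret h: semilinear_hom "free_algebra V" D \<theta> h by fact
  interpret k: semilinear_hom "free_algebra V" D \<theta> k by fact
  fix w assume "w \<in> carrier (free_monoid V)"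
  then have "w \<in> lists V" by (simp add: free_monoid_def)
  then show "h (Poly_Mapping.single w 1) = k (Poly_Mapping.single w 1)"
  proof (induction w)
    case Nil
    show ?case using h.ring_hom.hom_one k.ring_hom.hom_one
      by (simp add: free_algebra_def free_monoid_def)
  next
    case (Cons v w)
    then have "Poly_Mapping.single w (1::'k) \<in> carrier (free_algebra V)"
      by (simp add: free_algebra_def free_monoid_def)
    then show ?case
      using Cons by (simp add: free_algebra_single_Cons[of v w V] var_closed eq)
  qed
qed (use assms in \<open>simp_all add: free_algebra_def\<close>)

section \<open>Algebras presented by generators and relations\<close>

context
  fixes V :: "'v set" and R :: "(('v list \<Rightarrow>\<^sub>0 'k::field) \<times> ('v list \<Rightarrow>\<^sub>0 'k)) set"
  assumes R: "R \<subseteq> carrier (free_algebra V) \<times> carrier (free_algebra V)"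
begin

interpretation F: assoc_algebra "free_algebra V" by (rule assoc_algebra_free_algebra)

lemma relators_closed: "{a \<ominus>\<^bsub>free_algebra V\<^esub> b | a b. (a, b) \<in> R} \<subseteq> carrier (free_algebra V)"
  using R by auto

lemma relations_ideal: "ideal (relations_ideal V R) (free_algebra V)"
  unfolding relations_ideal_def by (rule F.genideal_ideal[OF relators_closed])

lemma presented_class_hom:
  "semilinear_hom (free_algebra V) (presented_algebra V R) (\<lambda>c. c) (presented_class V R)"
  using F.quotient_class_hom[OF relations_ideal] unfolding presented_algebra_def presented_class_def .

lemma presented_carrier: "carrier (presented_algebra V R) = presented_class V R ` carrier (free_algebra V)"
  using F.quotient_carrier[OF relations_ideal] unfolding presented_algebra_def presented_class_def .

lemma presented_class_eq:
  assumes "(a, b) \<in> R"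
  shows "presented_class V R a = presented_class V R b"
proof -
  have "a \<ominus>\<^bsub>free_algebra V\<^esub> b \<in> relations_ideal V R"
    using F.genideal_self[OF relators_closed] assms unfolding relations_ideal_def by blast
  then show ?thesis
    using F.quotient_class_eq_iff[OF relations_ideal] assms R unfolding presented_class_def by blast
qed

lemma presented_lift:
  assumes h: "semilinear_hom (free_algebra V) D \<theta> h" and eq: "\<forall>(a, b)\<in>R. h a = h b"
  shows "\<exists>k. semilinear_hom (presented_algebra V R) D \<theta> k \<and>
             (\<forall>a\<in>carrier (free_algebra V). k (presented_class V R a) = h a)"
proof -
  interpret h: semilinear_hom "free_algebra V" D \<theta> h by fact
  show ?thesis
    unfolding presented_algebra_def presented_class_def relations_ideal_def
  proof (rule F.quotient_lift[OF h relators_closed])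
    fix s assume "s \<in> {a \<ominus>\<^bsub>free_algebra V\<^esub> b | a b. (a, b) \<in> R}"
    then obtain a b where "s = a \<ominus>\<^bsub>free_algebra V\<^esub> b" "(a, b) \<in> R" by blast
    moreover from this have "a \<in> carrier (free_algebra V)" "b \<in> carrier (free_algebra V)"
      using R by blast+
    moreover have "h a = h b" using eq \<open>(a, b) \<in> R\<close> by blast
    ultimately show "h s = \<zero>\<^bsub>D\<^esub>" by (simp add: h.B.r_neg h.B.minus_eq)
  qed
qed

end

section \<open>Extension of scalars\<close>

context
  fixes A :: "('k::field, 'a, 'm) module_scheme" and \<iota> :: "'k \<Rightarrow> 'K::field"
  assumes A: "assoc_algebra A" and \<iota>: "scalar_hom \<iota>"
begin

interpretation A: assoc_algebra A by (rule A)

interpretation MA: assoc_algebra "monoid_algebra A :: ('K, 'a \<Rightarrow>\<^sub>0 'K) module"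
  by (rule A.assoc_algebra_monoid_algebra)

definition tensor_relators :: "('a \<Rightarrow>\<^sub>0 'K) set" where
  "tensor_relators =
    {Poly_Mapping.single (a \<oplus>\<^bsub>A\<^esub> b) 1 - (Poly_Mapping.single a 1 + Poly_Mapping.single b 1)
        | a b. a \<in> carrier A \<and> b \<in> carrier A}
     \<union> {Poly_Mapping.single (c \<odot>\<^bsub>A\<^esub> a) 1 - Poly_Mapping.single a (\<iota> c) | c a. a \<in> carrier A}"

text \<open>The relators are differences of finitely supported functions, whereas the lemmas on
  quotients speak of ring subtraction.\<close>

lemma monoid_algebra_minus:
  assumes "f \<in> carrier (monoid_algebra A :: ('K, 'a \<Rightarrow>\<^sub>0 'K) module)" "g \<in> carrier (monoid_algebra A :: ('K, 'a \<Rightarrow>\<^sub>0 'K) module)"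
  shows "f \<ominus>\<^bsub>monoid_algebra A\<^esub> g = f - g"
proof -
  have "\<ominus>\<^bsub>monoid_algebra A\<^esub> g = - g"
    using assms by (intro MA.minus_equality) auto
  then show ?thesis by (simp add: MA.minus_eq)
qed

lemma tensor_relators_closed: "tensor_relators \<subseteq> carrier (monoid_algebra A)"
proof
  fix s assume "s \<in> tensor_relators"
  then obtain f g where "s = f - g" "f \<in> carrier (monoid_algebra A)" "g \<in> carrier (monoid_algebra A)"
    unfolding tensor_relators_def by (fastforce simp: keys_add_subset)
  then show "s \<in> carrier (monoid_algebra A)"
    using MA.minus_closed monoid_algebra_minus by metis
qed

lemma tensor_ideal_eq: "tensor_ideal \<iota> A = Idl\<^bsub>monoid_algebra A\<^esub> tensor_relators"
  by (simp only: tensor_ideal_def tensor_relators_def)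

lemma ideal_tensor_ideal: "ideal (tensor_ideal \<iota> A) (monoid_algebra A)"
  unfolding tensor_ideal_eq by (rule MA.genideal_ideal[OF tensor_relators_closed])

lemma extend_scalars_class_hom:
  "semilinear_hom (monoid_algebra A) (extend_scalars \<iota> A) (\<lambda>c. c)
     (\<lambda>f. tensor_ideal \<iota> A +>\<^bsub>monoid_algebra A\<^esub> f)"
  unfolding extend_scalars_def by (rule MA.quotient_class_hom[OF ideal_tensor_ideal])

lemma tensor_class_eq:
  assumes "f - g \<in> tensor_relators" "f \<in> carrier (monoid_algebra A)" "g \<in> carrier (monoid_algebra A)"
  shows "tensor_ideal \<iota> A +>\<^bsub>monoid_algebra A\<^esub> f = tensor_ideal \<iota> A +>\<^bsub>monoid_algebra A\<^esub> g"
proof -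
  have "f - g \<in> tensor_ideal \<iota> A"
    using MA.genideal_self[OF tensor_relators_closed] assms(1) unfolding tensor_ideal_eq by blast
  then show ?thesis
    using MA.quotient_class_eq_iff[OF ideal_tensor_ideal] assms(2,3) monoid_algebra_minus by simp
qed

text \<open>Multiplicativity comes from [a][b] = [ab] in the monoid algebra; additivity and
  semilinearity are the two families of relators.\<close>

lemma tensor_hom: "semilinear_hom A (extend_scalars \<iota> A) \<iota> (tensor \<iota> A 1)"
proof -
  interpret c: semilinear_hom "monoid_algebra A" "extend_scalars \<iota> A" "\<lambda>c. c"
    "\<lambda>f. tensor_ideal \<iota> A +>\<^bsub>monoid_algebra A\<^esub> f" by (rule extend_scalars_class_hom)
  have single: "Poly_Mapping.single a 1 \<in> carrier (monoid_algebra A :: ('K, 'a \<Rightarrow>\<^sub>0 'K) module)"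
    if "a \<in> carrier A" for a using that by simp
  show ?thesis
  proof (intro semilinear_hom.intro semilinear_hom_axioms.intro A c.B.assoc_algebra_axioms \<iota>)
    show "tensor \<iota> A 1 \<in> ring_hom A (extend_scalars \<iota> A)"
    proof (rule ring_hom_memI)
      fix a b assume ab: "a \<in> carrier A" "b \<in> carrier A"
      show "tensor \<iota> A 1 a \<in> carrier (extend_scalars \<iota> A)"
        unfolding tensor_def by (rule c.ring_hom.hom_closed[OF single[OF ab(1)]])
      show "tensor \<iota> A 1 (a \<otimes>\<^bsub>A\<^esub> b)
          = tensor \<iota> A 1 a \<otimes>\<^bsub>extend_scalars \<iota> A\<^esub> tensor \<iota> A 1 b"
        unfolding tensor_def c.ring_hom.hom_mult[OF single[OF ab(1)] single[OF ab(2)], symmetric]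
        by (simp add: monoid_algebra_mult_single)
      have "tensor \<iota> A 1 (a \<oplus>\<^bsub>A\<^esub> b) = tensor_ideal \<iota> A +>\<^bsub>monoid_algebra A\<^esub>
          (Poly_Mapping.single a 1 \<oplus>\<^bsub>monoid_algebra A\<^esub> Poly_Mapping.single b 1)"
        unfolding tensor_def using ab
        by (intro tensor_class_eq MA.add.m_closed single A.add.m_closed)
          (auto simp: tensor_relators_def)
      then show "tensor \<iota> A 1 (a \<oplus>\<^bsub>A\<^esub> b)
          = tensor \<iota> A 1 a \<oplus>\<^bsub>extend_scalars \<iota> A\<^esub> tensor \<iota> A 1 b"
        unfolding tensor_def c.ring_hom.hom_add[OF single[OF ab(1)] single[OF ab(2)], symmetric] .
    next
      show "tensor \<iota> A 1 \<one>\<^bsub>A\<^esub> = \<one>\<^bsub>extend_scalars \<iota> A\<^esub>"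
        using c.ring_hom.hom_one by (simp add: tensor_def)
    qed
  next
    fix a c assume a: "a \<in> carrier A"
    have "tensor \<iota> A 1 (c \<odot>\<^bsub>A\<^esub> a)
        = tensor_ideal \<iota> A +>\<^bsub>monoid_algebra A\<^esub> Poly_Mapping.single a (\<iota> c)"
      unfolding tensor_def using a
      by (intro tensor_class_eq) (auto simp: tensor_relators_def)
    also have "Poly_Mapping.single a (\<iota> c) = \<iota> c \<odot>\<^bsub>monoid_algebra A\<^esub> Poly_Mapping.single a 1"
      by (simp add: map_times_single)
    also have "tensor_ideal \<iota> A +>\<^bsub>monoid_algebra A\<^esub> \<dots>
        = \<iota> c \<odot>\<^bsub>extend_scalars \<iota> A\<^esub> tensor \<iota> A 1 a"
      unfolding tensor_def by (rule c.hom_smult[OF single[OF a]])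
    finally show "tensor \<iota> A 1 (c \<odot>\<^bsub>A\<^esub> a) = \<iota> c \<odot>\<^bsub>extend_scalars \<iota> A\<^esub> tensor \<iota> A 1 a" .
  qed
qed

text \<open>Being multiplicative, \<open>h\<close> extends linearly to the monoid algebra of
  \<open>A\<close>; being additive and semilinear, it makes this extension vanish on the
  relators.\<close>

lemma extend_scalars_lift:
  assumes h: "semilinear_hom A D \<iota> h"
  shows "\<exists>k. semilinear_hom (extend_scalars \<iota> A) D (\<lambda>c. c) k \<and>
             (\<forall>a\<in>carrier A. k (tensor \<iota> A 1 a) = h a)"
proof -
  interpret h: semilinear_hom A D \<iota> h by fact
  interpret monoid_algebra_universal A D "\<lambda>c. c" h
    by (intro monoid_algebra_universal.intro monoid_algebra_universal_axioms.intro
        A.monoid_axioms h.B.assoc_algebra_axioms scalar_hom_id) simp_all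
  interpret L: semilinear_hom "monoid_algebra A" D "\<lambda>c. c" lift
    by (rule semilinear_hom_lift)
  have "\<exists>k. semilinear_hom (quotient_algebra (monoid_algebra A) (Idl\<^bsub>monoid_algebra A\<^esub> tensor_relators))
        D (\<lambda>c. c) k \<and>
      (\<forall>f\<in>carrier (monoid_algebra A).
        k (Idl\<^bsub>monoid_algebra A\<^esub> tensor_relators +>\<^bsub>monoid_algebra A\<^esub> f) = lift f)"
  proof (rule MA.quotient_lift[OF semilinear_hom_lift tensor_relators_closed])
    fix s assume "s \<in> tensor_relators"
    then obtain f g where s: "s = f - g" "f \<in> carrier (monoid_algebra A)"
      "g \<in> carrier (monoid_algebra A)" "lift f = lift g"
      unfolding tensor_relators_def by (fastforce simp: keys_add_subset lift_single lift_add)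
    then have "lift (f \<ominus>\<^bsub>monoid_algebra A\<^esub> g) = \<zero>\<^bsub>D\<^esub>"
      using L.hom_minus[OF s(2,3)] lift_closed[of g] by (simp add: h.B.minus_eq h.B.r_neg)
    then show "lift s = \<zero>\<^bsub>D\<^esub>" using s monoid_algebra_minus by simp
  qed
  then obtain k where k: "semilinear_hom (extend_scalars \<iota> A) D (\<lambda>c. c) k"
    "\<And>f. f \<in> carrier (monoid_algebra A) \<Longrightarrow> k (tensor_ideal \<iota> A +>\<^bsub>monoid_algebra A\<^esub> f) = lift f"
    unfolding extend_scalars_def tensor_ideal_eq by blast
  moreover have "k (tensor \<iota> A 1 a) = h a" if "a \<in> carrier A" for a
    using that k(2)[of "Poly_Mapping.single a 1"] by (simp add: tensor_def lift_single)
  ultimately show ?thesis by blast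
qed

text \<open>The symbols [a] span the monoid algebra, and their classes are the tensors of 1 with
  a.\<close>

lemma extend_scalars_hom_unique:
  assumes h: "semilinear_hom (extend_scalars \<iota> A) D (\<lambda>c. c) h"
    and k: "semilinear_hom (extend_scalars \<iota> A) D (\<lambda>c. c) k"
    and eq: "\<And>a. a \<in> carrier A \<Longrightarrow> h (tensor \<iota> A 1 a) = k (tensor \<iota> A 1 a)"
    and x: "x \<in> carrier (extend_scalars \<iota> A)"
  shows "h x = k x"
proof -
  obtain f where f: "f \<in> carrier (monoid_algebra A)" "x = tensor_ideal \<iota> A +>\<^bsub>monoid_algebra A\<^esub> f"
    using x MA.quotient_carrier[OF ideal_tensor_ideal] unfolding extend_scalars_def by blast
  show ?thesis
    unfolding f(2)
    by (rule monoid_algebra_hom_unique[OF semilinear_hom_comp[OF extend_scalars_class_hom h]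
          semilinear_hom_comp[OF extend_scalars_class_hom k] _ f(1)])
      (use eq in \<open>simp add: tensor_def\<close>)
qed

end

section \<open>Comparison of the two presentations\<close>

text \<open>Stated for families in an arbitrary algebra and for arbitrary scalars, so that it also
  applies over C(r, q), where l and m are replaced by their images.\<close>

definition B_relations ::
    "('k::field, 'a, 'm) module_scheme \<Rightarrow> 'v set \<Rightarrow> ('v \<Rightarrow> 'v \<Rightarrow> bool) \<Rightarrow> 'k \<Rightarrow> 'k
      \<Rightarrow> ('v \<Rightarrow> 'a) \<Rightarrow> ('v \<Rightarrow> 'a) \<Rightarrow> bool" where
  "B_relations D I adj l m G E \<longleftrightarrow>
    (\<forall>i\<in>I. \<forall>j\<in>I. \<not> adj i j \<longrightarrow> G i \<otimes>\<^bsub>D\<^esub> G j = G j \<otimes>\<^bsub>D\<^esub> G i) \<and>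
    (\<forall>i\<in>I. \<forall>j\<in>I. adj i j \<longrightarrow> G i \<otimes>\<^bsub>D\<^esub> G j \<otimes>\<^bsub>D\<^esub> G i = G j \<otimes>\<^bsub>D\<^esub> G i \<otimes>\<^bsub>D\<^esub> G j) \<and>
    (\<forall>i\<in>I. m \<odot>\<^bsub>D\<^esub> E i
      = l \<odot>\<^bsub>D\<^esub> (G i \<otimes>\<^bsub>D\<^esub> G i \<oplus>\<^bsub>D\<^esub> m \<odot>\<^bsub>D\<^esub> G i \<ominus>\<^bsub>D\<^esub> \<one>\<^bsub>D\<^esub>)) \<and>
    (\<forall>i\<in>I. G i \<otimes>\<^bsub>D\<^esub> E i = inverse l \<odot>\<^bsub>D\<^esub> E i) \<and>
    (\<forall>i\<in>I. \<forall>j\<in>I. adj i j \<longrightarrow> E i \<otimes>\<^bsub>D\<^esub> G j \<otimes>\<^bsub>D\<^esub> E i = l \<odot>\<^bsub>D\<^esub> E i)"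

definition BMW_e_of ::
    "('k::field, 'a, 'm) module_scheme \<Rightarrow> 'k \<Rightarrow> (nat \<Rightarrow> 'a) \<Rightarrow> (nat \<Rightarrow> 'a) \<Rightarrow> nat \<Rightarrow> 'a" where
  "BMW_e_of D q G H i =
    \<one>\<^bsub>D\<^esub> \<ominus>\<^bsub>D\<^esub> inverse (q - inverse q) \<odot>\<^bsub>D\<^esub> (G i \<ominus>\<^bsub>D\<^esub> H i)"

text \<open>For i = 1 the truncated difference \<open>i - 1\<close> is 0 and lies outside
  \<open>N\<close>, so the last two families start at i = 2.\<close>

definition BMW_relations ::
    "('k::field, 'a, 'm) module_scheme \<Rightarrow> nat \<Rightarrow> 'k \<Rightarrow> 'k \<Rightarrow> (nat \<Rightarrow> 'a) \<Rightarrow> (nat \<Rightarrow> 'a) \<Rightarrow> bool" where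
  "BMW_relations D k q r G H \<longleftrightarrow>
    (let N = {1..<k}; E = BMW_e_of D q G H in
    (\<forall>i\<in>N. G i \<otimes>\<^bsub>D\<^esub> H i = \<one>\<^bsub>D\<^esub>) \<and>
    (\<forall>i\<in>N. H i \<otimes>\<^bsub>D\<^esub> G i = \<one>\<^bsub>D\<^esub>) \<and>
    (\<forall>i. i \<in> N \<and> i + 1 \<in> N \<longrightarrow>
      G i \<otimes>\<^bsub>D\<^esub> G (i + 1) \<otimes>\<^bsub>D\<^esub> G i = G (i + 1) \<otimes>\<^bsub>D\<^esub> G i \<otimes>\<^bsub>D\<^esub> G (i + 1)) \<and>
    (\<forall>i\<in>N. \<forall>j\<in>N. \<bar>int i - int j\<bar> \<ge> 2 \<longrightarrow> G i \<otimes>\<^bsub>D\<^esub> G j = G j \<otimes>\<^bsub>D\<^esub> G i) \<and>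
    (\<forall>i\<in>N. E i \<otimes>\<^bsub>D\<^esub> G i = inverse r \<odot>\<^bsub>D\<^esub> E i) \<and>
    (\<forall>i. i \<in> N \<and> i - 1 \<in> N \<longrightarrow> E i \<otimes>\<^bsub>D\<^esub> G (i - 1) \<otimes>\<^bsub>D\<^esub> E i = r \<odot>\<^bsub>D\<^esub> E i) \<and>
    (\<forall>i. i \<in> N \<and> i - 1 \<in> N \<longrightarrow> E i \<otimes>\<^bsub>D\<^esub> H (i - 1) \<otimes>\<^bsub>D\<^esub> E i = inverse r \<odot>\<^bsub>D\<^esub> E i))"

lemma B_relations_cong:
  assumes "\<And>i. i \<in> I \<Longrightarrow> G i = G' i" "\<And>i. i \<in> I \<Longrightarrow> E i = E' i"
  shows "B_relations D I adj l m G E \<longleftrightarrow> B_relations D I adj l m G' E'"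
  using assms by (simp add: B_relations_def cong: ball_cong)

lemma BMW_relations_cong:
  assumes "\<And>i. i \<in> {1..<k} \<Longrightarrow> G i = G' i" "\<And>i. i \<in> {1..<k} \<Longrightarrow> H i = H' i"
  shows "BMW_relations D k q r G H \<longleftrightarrow> BMW_relations D k q r G' H'"
  using assms by (simp add: BMW_relations_def BMW_e_of_def Let_def cong: ball_cong conj_cong imp_cong
      del: atLeastLessThan_iff One_nat_def)

lemma A_adj_iff: "A_adj i j \<longleftrightarrow> j = i + 1 \<or> i = j + 1"
  unfolding A_adj_def by auto

section \<open>Passage between the two sets of relations\<close>

context assoc_algebra
begin

lemma bmw_braid_intro:
  assumes "is_bmw_triple l m g h e" "is_bmw_triple l m g' h' e'"
    and "g \<otimes> g' \<otimes> g = g' \<otimes> g \<otimes> g'"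
  shows "bmw_braid A l m g h e g' h' e'"
  using assms by unfold_locales

context
  fixes k :: nat and l m q :: 'k
  assumes m: "m = inverse q - q" and nz: "l \<noteq> 0" "m \<noteq> 0"
begin

text \<open>\<open>H\<close> is the inverse of \<open>G\<close> that \<open>bmw_triple_of_D1\<close>
  extracts from (D1) and (R1). The second claim says that the element e_i built from
  \<open>G\<close> and \<open>H\<close> is the given \<open>E\<close>.\<close>

lemma BMW_of_B_relations:
  assumes nz': "1 + l * m \<noteq> 0"
    and closed: "\<And>i. i \<in> {1..<k} \<Longrightarrow> G i \<in> carrier A" "\<And>i. i \<in> {1..<k} \<Longrightarrow> E i \<in> carrier A"
    and B: "B_relations A {1..<k} A_adj l m G E"
  defines "H \<equiv> \<lambda>i. G i \<oplus> m \<odot> \<one> \<ominus> m \<odot> E i"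
  shows "BMW_relations A k q l G H" and "i \<in> {1..<k} \<Longrightarrow> BMW_e_of A q G H i = E i"
proof -
  let ?N = "{1..<k}"
  have triple: "is_bmw_triple l m (G i) (H i) (E i)" if "i \<in> ?N" for i
    unfolding H_def using B that nz closed
    by (intro bmw_triple_of_D1) (auto simp: B_relations_def)
  have e_of: "BMW_e_of A q G H i = E i" if "i \<in> ?N" for i
  proof -
    interpret bmw_triple A l m "G i" "H i" "E i"
      by unfold_locales (rule triple[OF that])
    show ?thesis using e_eq unfolding BMW_e_of_def m by simp
  qed
  then show "i \<in> ?N \<Longrightarrow> BMW_e_of A q G H i = E i" .
  have inv: "G i \<otimes> H i = \<one>" "H i \<otimes> G i = \<one>" "E i \<otimes> G i = inverse l \<odot> E i" if "i \<in> ?N" for i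
    using triple[OF that] unfolding is_bmw_triple_def by blast+
  have braid: "G i \<otimes> G (i + 1) \<otimes> G i = G (i + 1) \<otimes> G i \<otimes> G (i + 1)"
    if "i \<in> ?N" "i + 1 \<in> ?N" for i
    using B that unfolding B_relations_def A_adj_iff by blast
  have comm: "G i \<otimes> G j = G j \<otimes> G i" if "i \<in> ?N" "j \<in> ?N" "\<bar>int i - int j\<bar> \<ge> 2" for i j
  proof -
    have "\<not> A_adj i j" using that(3) by (simp add: A_adj_def)
    then show ?thesis using B that(1,2) unfolding B_relations_def by blast
  qed
  have R2: "E i \<otimes> G (i - 1) \<otimes> E i = l \<odot> E i" "E i \<otimes> H (i - 1) \<otimes> E i = inverse l \<odot> E i"
    if "i \<in> ?N" "i - 1 \<in> ?N" for i
  proof -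
    have adj: "A_adj i (i - 1)" using that by (auto simp: A_adj_iff)
    then show R2: "E i \<otimes> G (i - 1) \<otimes> E i = l \<odot> E i"
      using B that unfolding B_relations_def by blast
    have "G i \<otimes> G (i - 1) \<otimes> G i = G (i - 1) \<otimes> G i \<otimes> G (i - 1)"
      using B that adj unfolding B_relations_def by blast
    then interpret bmw_braid A l m "G i" "H i" "E i" "G (i - 1)" "H (i - 1)" "E (i - 1)"
      by (intro bmw_braid_intro triple that)
    show "E i \<otimes> H (i - 1) \<otimes> E i = inverse l \<odot> E i" by (rule e_h'_e[OF R2 nz'])
  qed
  show "BMW_relations A k q l G H"
    unfolding BMW_relations_def Let_def using inv braid comm R2 by (simp add: e_of)
qed

lemma B_of_BMW_relations:
  assumes closed: "\<And>i. i \<in> {1..<k} \<Longrightarrow> G i \<in> carrier A" "\<And>i. i \<in> {1..<k} \<Longrightarrow> H i \<in> carrier A"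
    and BMW: "BMW_relations A k q l G H"
  shows "B_relations A {1..<k} A_adj l m G (BMW_e_of A q G H)"
    and "i \<in> {1..<k} \<Longrightarrow> H i = G i \<oplus> m \<odot> \<one> \<ominus> m \<odot> BMW_e_of A q G H i"
proof -
  let ?N = "{1..<k}"
  define E where "E = BMW_e_of A q G H"
  have rels:
    "\<And>i. i \<in> ?N \<Longrightarrow> G i \<otimes> H i = \<one>" "\<And>i. i \<in> ?N \<Longrightarrow> H i \<otimes> G i = \<one>"
    "\<And>i. i \<in> ?N \<Longrightarrow> i + 1 \<in> ?N \<Longrightarrow> G i \<otimes> G (i + 1) \<otimes> G i = G (i + 1) \<otimes> G i \<otimes> G (i + 1)"
    "\<And>i j. i \<in> ?N \<Longrightarrow> j \<in> ?N \<Longrightarrow> \<bar>int i - int j\<bar> \<ge> 2 \<Longrightarrow> G i \<otimes> G j = G j \<otimes> G i"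
    "\<And>i. i \<in> ?N \<Longrightarrow> E i \<otimes> G i = inverse l \<odot> E i"
    "\<And>i. i \<in> ?N \<Longrightarrow> i - 1 \<in> ?N \<Longrightarrow> E i \<otimes> G (i - 1) \<otimes> E i = l \<odot> E i"
    using BMW unfolding BMW_relations_def Let_def E_def[symmetric] by blast+
  have triple: "is_bmw_triple l m (G i) (H i) (E i)" if "i \<in> ?N" for i
  proof (rule bmw_triple_of_inverse)
    show "E i = \<one> \<ominus> inverse (- m) \<odot> (G i \<ominus> H i)"
      by (simp add: E_def BMW_e_of_def m)
    then show "E i \<in> carrier A" using closed that by simp
  qed (use rels closed that nz in auto)
  then show "i \<in> {1..<k} \<Longrightarrow> H i = G i \<oplus> m \<odot> \<one> \<ominus> m \<odot> BMW_e_of A q G H i"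
    by (simp add: is_bmw_triple_def E_def)
  have up: "bmw_braid A l m (G i) (H i) (E i) (G (i + 1)) (H (i + 1)) (E (i + 1))"
    if "i \<in> ?N" "i + 1 \<in> ?N" for i
    by (intro bmw_braid_intro triple rels that)
  have "E i \<otimes> G j \<otimes> E i = l \<odot> E i" if ij: "i \<in> ?N" "j \<in> ?N" "A_adj i j" for i j
    using ij(3) unfolding A_adj_iff
  proof
    \<comment> \<open>The BMW relations involve only the lower neighbour of a node. At node j = i +
      1 they give E j G i E j = l E j, which \<open>e_k_e_of_f_g_f\<close> carries over to node
      i.\<close>
    assume j: "j = i + 1"
    interpret bmw_braid A l m "G i" "H i" "E i" "G (i + 1)" "H (i + 1)" "E (i + 1)"
      using up ij j by simp
    show ?thesis using rels(6)[of "i + 1"] ij j by (intro e_k_e_of_f_g_f[folded j]) simp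
  next
    assume "i = j + 1"
    then show ?thesis using rels(6)[of i] ij by simp
  qed
  moreover have "G i \<otimes> G j \<otimes> G i = G j \<otimes> G i \<otimes> G j" if "i \<in> ?N" "j \<in> ?N" "A_adj i j" for i j
    using that rels(3)[of i] rels(3)[of j] unfolding A_adj_iff by auto
  moreover have "G i \<otimes> G j = G j \<otimes> G i" if "i \<in> ?N" "j \<in> ?N" "\<not> A_adj i j" for i j
  \<comment> \<open>A node is not adjacent to itself, so (B1) includes the trivial case i =
    j.\<close>
  proof (cases "i = j")
    case False
    then have "\<bar>int i - int j\<bar> \<ge> 2" using that(3) by (simp add: A_adj_def)
    then show ?thesis using rels(4) that by blast
  qed simp
  moreover have "m \<odot> E i = l \<odot> (G i \<otimes> G i \<oplus> m \<odot> G i \<ominus> \<one>)" "G i \<otimes> E i = inverse l \<odot> E i"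
    if "i \<in> ?N" for i
  proof -
    interpret bmw_triple A l m "G i" "H i" "E i"
      by unfold_locales (rule triple[OF that])
    show "m \<odot> E i = l \<odot> (G i \<otimes> G i \<oplus> m \<odot> G i \<ominus> \<one>)" by (rule D1)
    show "G i \<otimes> E i = inverse l \<odot> E i" by (rule g_e)
  qed
  ultimately show "B_relations A ?N A_adj l m G (BMW_e_of A q G H)"
    unfolding B_relations_def E_def[symmetric] by blast
qed

end

end

section \<open>Homomorphisms respecting the defining relations\<close>

lemma B_gens_closed:
  assumes "i \<in> I"
  shows "var (Gen_g i) \<in> carrier (free_algebra (B_gens I))"
    and "var (Gen_e i) \<in> carrier (free_algebra (B_gens I))"
  using assms by (auto intro!: var_closed simp: B_gens_def)

lemma BMW_gens_closed:
  assumes "i \<in> {1..<k}"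
  shows "var (Bmw_g i) \<in> carrier (free_algebra (BMW_gens k))"
    and "var (Bmw_ginv i) \<in> carrier (free_algebra (BMW_gens k))"
  using assms by (auto intro!: var_closed simp: BMW_gens_def)

lemma BMW_elem_e_closed:
  assumes "i \<in> {1..<k}"
  shows "BMW_elem_e k i \<in> carrier (free_algebra (BMW_gens k))"
proof -
  interpret assoc_algebra "free_algebra (BMW_gens k) :: (complex ratfun2, _) module"
    by (rule assoc_algebra_free_algebra)
  show ?thesis using assms by (simp add: BMW_elem_e_def Let_def BMW_gens_closed)
qed

lemma B_rels_closed:
  "B_rels I adj \<subseteq> carrier (free_algebra (B_gens I)) \<times> carrier (free_algebra (B_gens I))"
proof -
  interpret assoc_algebra "free_algebra (B_gens I) :: (rat ratfun2, _) module"
    by (rule assoc_algebra_free_algebra)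
  show ?thesis unfolding B_rels_def Let_def by (auto simp: B_gens_closed)
qed

lemma BMW_rels_closed:
  "BMW_rels k \<subseteq> carrier (free_algebra (BMW_gens k)) \<times> carrier (free_algebra (BMW_gens k))"
proof -
  interpret assoc_algebra "free_algebra (BMW_gens k) :: (complex ratfun2, _) module"
    by (rule assoc_algebra_free_algebra)
  note closed = BMW_gens_closed BMW_elem_e_closed
  show ?thesis
    unfolding BMW_rels_def Let_def
    by (intro Un_least subsetI; elim CollectE exE conjE; simp add: closed del: atLeastLessThan_iff)
qed

context
  fixes I :: "'v set" and D :: "('k::field, 'a, 'm) module_scheme" and \<theta>
    and h :: "('v gen list \<Rightarrow>\<^sub>0 rat ratfun2) \<Rightarrow> 'a"
  assumes h: "semilinear_hom (free_algebra (B_gens I)) D \<theta> h"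
begin

interpretation h: semilinear_hom "free_algebra (B_gens I)" D \<theta> h by (rule h)

text \<open>Used in both directions: for the class map it yields the relations among the generators,
  and for a map given on generators it yields the condition under which the map descends. Scalars
  pass through \<theta>.\<close>

lemma B_rels_iff:
  "(\<forall>(a, b)\<in>B_rels I adj. h a = h b) \<longleftrightarrow>
    B_relations D I adj (\<theta> par_l) (\<theta> par_m) (\<lambda>i. h (var (Gen_g i))) (\<lambda>i. h (var (Gen_e i)))"
proof -
  have sq: "g [^]\<^bsub>free_algebra (B_gens I)\<^esub> (2::nat) = g \<otimes>\<^bsub>free_algebra (B_gens I)\<^esub> g"
    if "g \<in> carrier (free_algebra (B_gens I))" for g :: "'v gen list \<Rightarrow>\<^sub>0 rat ratfun2"
    using that by (simp add: numeral_2_eq_2)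
  have ball: "(\<forall>x\<in>{u i j | i j. P i j}. Q x) \<longleftrightarrow> (\<forall>i j. P i j \<longrightarrow> Q (u i j))"
    "(\<forall>x\<in>{v i | i. R i}. Q x) \<longleftrightarrow> (\<forall>i. R i \<longrightarrow> Q (v i))"
    for u :: "'v \<Rightarrow> 'v \<Rightarrow> ('v gen list \<Rightarrow>\<^sub>0 rat ratfun2) \<times> ('v gen list \<Rightarrow>\<^sub>0 rat ratfun2)" and v P Q R
    by blast+
  show ?thesis
    unfolding B_rels_def Let_def ball_Un ball B_relations_def
    by (simp add: B_gens_closed sq scalar_hom_inverse[OF h.scalar.scalar_hom_axioms] Ball_def
        imp_conjL cong: imp_cong conj_cong)
qed

end

context
  fixes k :: nat and D :: "(complex ratfun2, 'a, 'm) module_scheme"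
    and h :: "(bmw_gen list \<Rightarrow>\<^sub>0 complex ratfun2) \<Rightarrow> 'a"
  assumes h: "semilinear_hom (free_algebra (BMW_gens k)) D (\<lambda>c. c) h"
begin

interpretation h: semilinear_hom "free_algebra (BMW_gens k)" D "\<lambda>c. c" h by (rule h)

lemma hom_BMW_elem_e:
  assumes "i \<in> {1..<k}"
  shows "h (BMW_elem_e k i) = BMW_e_of D par_q (\<lambda>i. h (var (Bmw_g i))) (\<lambda>i. h (var (Bmw_ginv i))) i"
  by (simp add: BMW_elem_e_def BMW_e_of_def Let_def BMW_gens_closed[OF assms])

lemma BMW_rels_iff:
  "(\<forall>(a, b)\<in>BMW_rels k. h a = h b) \<longleftrightarrow>
    BMW_relations D k par_q par_r (\<lambda>i. h (var (Bmw_g i))) (\<lambda>i. h (var (Bmw_ginv i)))"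
proof -
  have ball: "(\<forall>x\<in>{u i j | i j. P i j}. Q x) \<longleftrightarrow> (\<forall>i j. P i j \<longrightarrow> Q (u i j))"
    "(\<forall>x\<in>{v i | i. R i}. Q x) \<longleftrightarrow> (\<forall>i. R i \<longrightarrow> Q (v i))"
    for u :: "nat \<Rightarrow> nat \<Rightarrow> (bmw_gen list \<Rightarrow>\<^sub>0 complex ratfun2) \<times> (bmw_gen list \<Rightarrow>\<^sub>0 complex ratfun2)"
      and v P Q R
    by blast+
  show ?thesis
    unfolding BMW_rels_def Let_def ball_Un ball BMW_relations_def
    by (simp add: BMW_gens_closed BMW_elem_e_closed hom_BMW_elem_e Ball_def
        imp_conjL cong: imp_cong conj_cong del: atLeastLessThan_iff One_nat_def)
qed

end

theorem theorem2p7: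
  fixes n :: nat
  assumes "n \<ge> 2"
  shows "\<exists>\<iota> \<in> ring_hom (ring_of_type_algebra :: rat ratfun2 ring)
                       (ring_of_type_algebra :: complex ratfun2 ring).
      \<iota> par_l = par_r \<and> \<iota> par_m = inverse par_q - par_q \<and>
      (let I = A_nodes (n - 1); B = B_algebra I A_adj in
       \<exists>\<phi> \<in> algebra_iso (extend_scalars \<iota> B) (BMW n).
         \<forall>i\<in>I. \<phi> (tensor \<iota> B 1 (B_g I A_adj i)) = BMW_g n i \<and>
               \<phi> (tensor \<iota> B 1 (B_e I A_adj i)) = BMW_e n i)"
proof -
  obtain \<iota> :: "rat ratfun2 \<Rightarrow> complex ratfun2" where \<iota>: "scalar_hom \<iota>"
    and \<iota>_l: "\<iota> par_l = par_r" and \<iota>_m: "\<iota> par_m = inverse par_q - par_q"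
    using ex_scalar_embedding by blast
  define I where "I = A_nodes (n - 1)"
  define B where "B = B_algebra I A_adj"
  let ?K = "extend_scalars \<iota> B" and ?m = "inverse par_q - par_q"
  have I: "I = {1..<n}" using assms by (auto simp: I_def A_nodes_def)
  have m: "?m \<noteq> 0" using par_q_diff_nonzero by simp
  note scalars = refl[of ?m] par_r_nonzero m

  interpret cB: semilinear_hom "free_algebra (B_gens I)" B "\<lambda>c. c"
    "presented_class (B_gens I) (B_rels I A_adj)"
    unfolding B_def B_algebra_def by (rule presented_class_hom[OF B_rels_closed])
  interpret cM: semilinear_hom "free_algebra (BMW_gens n)" "BMW n" "\<lambda>c. c"
    "presented_class (BMW_gens n) (BMW_rels n)"
    unfolding BMW_def by (rule presented_class_hom[OF BMW_rels_closed])
  have B: "assoc_algebra B" by (rule cB.B.assoc_algebra_axioms)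
  interpret T: semilinear_hom B ?K \<iota> "tensor \<iota> B 1" by (rule tensor_hom[OF B \<iota>])

  define G where "G = BMW_g n"
  define H where "H i = presented_class (BMW_gens n) (BMW_rels n) (var (Bmw_ginv i))" for i
  define E where "E = BMW_e n"
  have G_H_closed: "G i \<in> carrier (BMW n)" "H i \<in> carrier (BMW n)" "E i \<in> carrier (BMW n)"
    if "i \<in> {1..<n}" for i
    unfolding G_def BMW_g_def H_def E_def BMW_e_def
    by (intro cM.ring_hom.hom_closed BMW_gens_closed BMW_elem_e_closed that)+
  have E_eq: "E i = BMW_e_of (BMW n) par_q G H i" if "i \<in> {1..<n}" for i
    using hom_BMW_elem_e[OF cM.semilinear_hom_axioms that]
    by (simp add: G_def BMW_g_def[abs_def] H_def[abs_def] E_def BMW_e_def)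
  \<comment> \<open>The class map identifies the two sides of each relation, so the generators of
    \<open>BMW n\<close> satisfy \<open>BMW_relations\<close>.\<close>
  have BMW_GH: "BMW_relations (BMW n) n par_q par_r G H"
    using BMW_rels_iff[OF cM.semilinear_hom_axioms] presented_class_eq[OF BMW_rels_closed]
    unfolding G_def BMW_g_def[abs_def] H_def[abs_def] by blast
  note B_GH = cM.B.B_of_BMW_relations[OF scalars G_H_closed(1,2) BMW_GH]
  have B_GE: "B_relations (BMW n) I A_adj par_r ?m G E"
    using B_GH(1) B_relations_cong[of I G G E] E_eq unfolding I by blast
  have H_eq: "H i = G i \<oplus>\<^bsub>BMW n\<^esub> ?m \<odot>\<^bsub>BMW n\<^esub> \<one>\<^bsub>BMW n\<^esub> \<ominus>\<^bsub>BMW n\<^esub> ?m \<odot>\<^bsub>BMW n\<^esub> E i"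
    if "i \<in> {1..<n}" for i
    using B_GH(2)[OF _ _ that] that by (simp add: E_eq)

  \<comment> \<open>Construction of \<phi>: the elements \<open>G\<close> and \<open>E\<close>
    define a semilinear map \<beta> on B(M), which then extends linearly to the scalar
    extension.\<close>
  define f where "f v = (case v of Gen_g i \<Rightarrow> G i | Gen_e i \<Rightarrow> E i)" for v
  have "f v \<in> carrier (BMW n)" if "v \<in> B_gens I" for v
    using that G_H_closed by (auto simp: B_gens_def f_def I)
  from free_algebra_hom_exists[OF cM.B.assoc_algebra_axioms \<iota>, of "B_gens I" f, OF this]
  obtain h where h: "semilinear_hom (free_algebra (B_gens I)) (BMW n) \<iota> h"
    and h_var: "\<And>v. v \<in> B_gens I \<Longrightarrow> h (var v) = f v" by blast
  have h_gens: "h (var (Gen_g i)) = G i" "h (var (Gen_e i)) = E i" if "i \<in> I" for i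
    using that h_var by (simp_all add: B_gens_def f_def)
  have "B_relations (BMW n) I A_adj (\<iota> par_l) (\<iota> par_m)
      (\<lambda>i. h (var (Gen_g i))) (\<lambda>i. h (var (Gen_e i)))"
    unfolding \<iota>_l \<iota>_m
    using B_GE by (subst B_relations_cong[where G' = G and E' = E]) (simp_all add: h_gens)
  then have "\<forall>(a, b)\<in>B_rels I A_adj. h a = h b" by (simp only: B_rels_iff[OF h])
  from presented_lift[OF B_rels_closed h this]
  obtain \<beta> where \<beta>: "semilinear_hom B (BMW n) \<iota> \<beta>"
    and \<beta>_class: "\<And>a. a \<in> carrier (free_algebra (B_gens I)) \<Longrightarrow>
      \<beta> (presented_class (B_gens I) (B_rels I A_adj) a) = h a"
    unfolding B_def B_algebra_def by blast
  from extend_scalars_lift[OF B \<iota> \<beta>]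
  obtain \<phi> where \<phi>: "semilinear_hom ?K (BMW n) (\<lambda>c. c) \<phi>"
    and \<phi>_tensor: "\<And>b. b \<in> carrier B \<Longrightarrow> \<phi> (tensor \<iota> B 1 b) = \<beta> b" by blast
  interpret \<beta>: semilinear_hom B "BMW n" \<iota> \<beta> by (rule \<beta>)
  interpret \<phi>: semilinear_hom ?K "BMW n" "\<lambda>c. c" \<phi> by (rule \<phi>)

  define G' where "G' i = tensor \<iota> B 1 (B_g I A_adj i)" for i
  define E' where "E' i = tensor \<iota> B 1 (B_e I A_adj i)" for i
  have B_closed: "B_g I A_adj i \<in> carrier B" "B_e I A_adj i \<in> carrier B" if "i \<in> I" for i
    unfolding B_g_def B_e_def by (intro cB.ring_hom.hom_closed B_gens_closed that)+
  have G'_E'_closed: "G' i \<in> carrier ?K" "E' i \<in> carrier ?K" if "i \<in> {1..<n}" for i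
    unfolding G'_def E'_def using B_closed that by (simp_all add: I)
  have \<phi>_G': "\<phi> (G' i) = G i" and \<phi>_E': "\<phi> (E' i) = E i" if "i \<in> I" for i
    using that B_closed[OF that]
    by (simp_all add: G'_def E'_def \<phi>_tensor B_g_def B_e_def \<beta>_class B_gens_closed h_gens)
  note TcB = semilinear_hom_comp[OF cB.semilinear_hom_axioms T.semilinear_hom_axioms]
  \<comment> \<open>Along the class map followed by the tensor map, l and m turn into r and q^-1 -
    q.\<close>
  have "B_relations ?K I A_adj par_r ?m G' E'"
    using B_rels_iff[OF TcB] presented_class_eq[OF B_rels_closed]
    unfolding G'_def[abs_def] E'_def[abs_def] B_g_def B_e_def \<iota>_l \<iota>_m by fastforce
  then have B_GE': "B_relations ?K {1..<n} A_adj par_r ?m G' E'" by (simp add: I)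
  define H' where "H' i = G' i \<oplus>\<^bsub>?K\<^esub> ?m \<odot>\<^bsub>?K\<^esub> \<one>\<^bsub>?K\<^esub> \<ominus>\<^bsub>?K\<^esub> ?m \<odot>\<^bsub>?K\<^esub> E' i" for i
  have H'_closed: "H' i \<in> carrier ?K" if "i \<in> {1..<n}" for i
    using G'_E'_closed[OF that] by (simp add: H'_def)
  note BMW_GH' = T.B.BMW_of_B_relations[OF scalars one_plus_r_m_nonzero G'_E'_closed B_GE',
      folded H'_def[abs_def]]
  \<comment> \<open>\<open>H_eq\<close> writes \<open>H\<close> in terms of \<open>G\<close> and
    \<open>E\<close> by the formula that defines \<open>H'\<close> from \<open>G'\<close> and
    \<open>E'\<close>.\<close>
  have \<phi>_H': "\<phi> (H' i) = H i" if "i \<in> I" for i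
    using that G'_E'_closed[of i] \<phi>_G'[of i] \<phi>_E'[of i] H_eq[of i] by (simp add: H'_def I)

  \<comment> \<open>Construction of the inverse map \<psi>: \<open>G'\<close> and the elements
    \<open>H'\<close>, inverse to them, satisfy the BMW relations in the scalar extension.\<close>
  define f' where "f' v = (case v of Bmw_g i \<Rightarrow> G' i | Bmw_ginv i \<Rightarrow> H' i)" for v
  have "f' v \<in> carrier ?K" if "v \<in> BMW_gens n" for v
    using that G'_E'_closed H'_closed by (auto simp: BMW_gens_def f'_def)
  from free_algebra_hom_exists[OF T.B.assoc_algebra_axioms scalar_hom_id, of "BMW_gens n" f', OF this]
  obtain h' where h': "semilinear_hom (free_algebra (BMW_gens n)) ?K (\<lambda>c. c) h'"
    and h'_var: "\<And>v. v \<in> BMW_gens n \<Longrightarrow> h' (var v) = f' v" by blast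
  interpret h': semilinear_hom "free_algebra (BMW_gens n)" ?K "\<lambda>c. c" h' by (rule h')
  have h'_gens: "h' (var (Bmw_g i)) = G' i" "h' (var (Bmw_ginv i)) = H' i" if "i \<in> {1..<n}" for i
    using that h'_var by (simp_all add: BMW_gens_def f'_def)
  have h'_e: "h' (BMW_elem_e n i) = E' i" if "i \<in> {1..<n}" for i
    using hom_BMW_elem_e[OF h' that] BMW_GH'(2) that h'_gens[OF that] by (simp add: BMW_e_of_def)
  have "BMW_relations ?K n par_q par_r (\<lambda>i. h' (var (Bmw_g i))) (\<lambda>i. h' (var (Bmw_ginv i)))"
    using BMW_GH'(1) by (subst BMW_relations_cong[where G' = G' and H' = H']) (simp_all add: h'_gens)
  then have "\<forall>(a, b)\<in>BMW_rels n. h' a = h' b" by (simp only: BMW_rels_iff[OF h'])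
  from presented_lift[OF BMW_rels_closed h' this]
  obtain \<psi> where \<psi>: "semilinear_hom (BMW n) ?K (\<lambda>c. c) \<psi>"
    and \<psi>_class: "\<And>a. a \<in> carrier (free_algebra (BMW_gens n)) \<Longrightarrow>
      \<psi> (presented_class (BMW_gens n) (BMW_rels n) a) = h' a"
    unfolding BMW_def by blast
  interpret \<psi>: semilinear_hom "BMW n" ?K "\<lambda>c. c" \<psi> by (rule \<psi>)
  have \<psi>_G: "\<psi> (G i) = G' i" and \<psi>_E: "\<psi> (E i) = E' i" if "i \<in> {1..<n}" for i
    using that by (simp_all add: G_def BMW_g_def E_def BMW_e_def \<psi>_class BMW_gens_closed
        BMW_elem_e_closed h'_gens h'_e del: atLeastLessThan_iff)

  \<comment> \<open>Both sides are homomorphisms on classes of the free algebra, so they are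
    compared on the generators and their inverses.\<close>
  have "\<phi> (\<psi> y) = y" if y: "y \<in> carrier (BMW n)" for y
  proof -
    obtain a where a: "a \<in> carrier (free_algebra (BMW_gens n))"
      "y = presented_class (BMW_gens n) (BMW_rels n) a"
      using y unfolding BMW_def presented_carrier[OF BMW_rels_closed] by (rule imageE)
    have "\<phi> (h' a) = presented_class (BMW_gens n) (BMW_rels n) a"
    proof (rule free_algebra_hom_unique[OF semilinear_hom_comp[OF h' \<phi>] cM.semilinear_hom_axioms _ a(1)])
      fix v assume "v \<in> BMW_gens n"
      then obtain i where i: "i \<in> {1..<n}" "v = Bmw_g i \<or> v = Bmw_ginv i"
        unfolding BMW_gens_def by blast
      then show "\<phi> (h' (var v)) = presented_class (BMW_gens n) (BMW_rels n) (var v)"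
        using \<phi>_G'[of i] \<phi>_H'[of i] h'_gens[of i] unfolding I
        by (auto simp: G_def BMW_g_def H_def)
    qed
    then show ?thesis using a \<psi>_class by simp
  qed
  \<comment> \<open>Uniqueness for scalar extensions reduces this to tensors of 1 with elements of
    B(M), and uniqueness for free algebras reduces it further to the generators g_i and e_i.\<close>
  moreover have "\<psi> (\<phi> x) = x" if x: "x \<in> carrier ?K" for x
  proof (rule extend_scalars_hom_unique[OF B \<iota> semilinear_hom_comp[OF \<phi> \<psi>] _ _ x])
    show "semilinear_hom ?K ?K (\<lambda>c. c) (\<lambda>x. x)"
      by (intro semilinear_hom.intro semilinear_hom_axioms.intro T.B.assoc_algebra_axioms
          scalar_hom_id ring_hom_memI refl)
    fix b assume b: "b \<in> carrier B"
    obtain a where a: "a \<in> carrier (free_algebra (B_gens I))"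
      "b = presented_class (B_gens I) (B_rels I A_adj) a"
      using b unfolding B_def B_algebra_def presented_carrier[OF B_rels_closed] by (rule imageE)
    have "\<psi> (h a) = tensor \<iota> B 1 (presented_class (B_gens I) (B_rels I A_adj) a)"
    proof (rule free_algebra_hom_unique[OF semilinear_hom_comp[OF h \<psi>] TcB _ a(1)])
      fix v assume "v \<in> B_gens I"
      then obtain i where i: "i \<in> I" "v = Gen_g i \<or> v = Gen_e i"
        unfolding B_gens_def by blast
      then show "\<psi> (h (var v)) = tensor \<iota> B 1 (presented_class (B_gens I) (B_rels I A_adj) (var v))"
        using \<psi>_G[of i] \<psi>_E[of i] h_gens[of i]
        by (auto simp: I G'_def E'_def B_g_def B_e_def)
    qed
    then show "\<psi> (\<phi> (tensor \<iota> B 1 b)) = tensor \<iota> B 1 b"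
      using a b \<beta>_class \<phi>_tensor by simp
  qed
  ultimately have "bij_betw \<phi> (carrier ?K) (carrier (BMW n))"
    by (intro bij_betw_byWitness[where f' = \<psi>]) auto
  then have iso: "\<phi> \<in> algebra_iso ?K (BMW n)"
    using \<phi>.ring_hom by (simp add: algebra_iso_def ring_iso_def)
  show ?thesis
  proof (intro bexI[of _ \<iota>] conjI)
    show "let I = A_nodes (n - 1); B = B_algebra I A_adj in
       \<exists>\<phi> \<in> algebra_iso (extend_scalars \<iota> B) (BMW n).
         \<forall>i\<in>I. \<phi> (tensor \<iota> B 1 (B_g I A_adj i)) = BMW_g n i \<and>
               \<phi> (tensor \<iota> B 1 (B_e I A_adj i)) = BMW_e n i"
      unfolding Let_def I_def[symmetric] B_def[symmetric]
      using iso \<phi>_G' \<phi>_E' unfolding G'_def E'_def G_def E_def by blast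
  qed (use \<iota> \<iota>_l \<iota>_m in \<open>simp_all add: scalar_hom_iff_ring_hom\<close>)
qed

end
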